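(* There exist a computable probability measure $\mu$ on $2^\omega$ and a sequence $X\in 2^\omega$ such that $X$ is not computably $\mu$-random, yet no total computable $\mu$-martingale succeeds on $X$.
   Context: For a probability measure $\mu$ on $2^\omega$ write $\mu(\sigma)=\mu([\sigma])$, where $[\sigma]$ is the set of sequences extending the string $\sigma$. $\mu$ is computable if $\sigma\mapsto\mu(\sigma)$ is a computable real uniformly in $\sigma$. A martingale with respect to $\mu$ (a $\mu$-martingale) is a partial function $M:2^{<\omega}\to[0,\infty)$ such that (i) $M(\sigma)$ is defined whenever $\mu(\sigma)>0$, and (ii) $M(\sigma 0)\mu(\sigma 0)+M(\sigma 1)\mu(\sigma 1)=M(\sigma)\mu(\sigma)$ for all $\sigma$ (terms with $\mu(\cdot)=0$ are treated as $0$). $M$ is computable if there is a partial computable procedure which, on each $\sigma$ in its domain, outputs a Cauchy name of the real $M(\sigma)$; it is total if it is defined on all of $2^{<\omega}$. $M$ succeeds on $X$ if $\limsup_n M(X\upharpoonright n)=\infty$. $X$ is computably $\mu$-random if no computable (possibly partial) $\mu$-martingale succeeds on $X$. *)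

theory Defs
  imports "HOL-Probability.Probability" "HOL-Library.Nat_Bijection"
begin

datatype recf = Zero | SucF | Proj nat | Comp recf "recf list" | Prim recf recf | Mu recf

declare list_all2_mono[mono]

inductive eval :: "recf \<Rightarrow> nat list \<Rightarrow> nat \<Rightarrow> bool" where
  eval_Zero: "eval Zero xs 0"
| eval_Suc: "eval SucF (x # xs) (Suc x)"
| eval_Proj: "i < length xs \<Longrightarrow> eval (Proj i) xs (xs ! i)"
| eval_Comp: "list_all2 (\<lambda>g y. eval g xs y) gs ys \<Longrightarrow> eval f ys z \<Longrightarrow> eval (Comp f gs) xs z"
| eval_Prim0: "eval f xs y \<Longrightarrow> eval (Prim f g) (0 # xs) y"
| eval_PrimS: "eval (Prim f g) (n # xs) y \<Longrightarrow> eval g (n # y # xs) z \<Longrightarrow>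
     eval (Prim f g) (Suc n # xs) z"
| eval_Mu: "eval f (n # xs) 0 \<Longrightarrow> (\<forall>m<n. \<exists>y. eval f (m # xs) (Suc y)) \<Longrightarrow>
     eval (Mu f) xs n"

fun str_code :: "bool list \<Rightarrow> nat" where
  "str_code [] = 0"
| "str_code (b # xs) = 2 * str_code xs + (if b then 2 else 1)"

definition rat_code :: "nat \<Rightarrow> real" where
  "rat_code n = (case prod_decode n of (a, b) \<Rightarrow> of_int (int_decode a) / real (Suc b))"

definition cantor :: "(nat \<Rightarrow> bool) measure" where
  "cantor = Pi\<^sub>M UNIV (\<lambda>_. count_space UNIV)"

definition cyl :: "bool list \<Rightarrow> (nat \<Rightarrow> bool) set" where
  "cyl \<sigma> = {X. \<forall>i<length \<sigma>. X i = \<sigma> ! i}"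

definition prefix :: "(nat \<Rightarrow> bool) \<Rightarrow> nat \<Rightarrow> bool list" where
  "prefix X n = map X [0..<n]"

definition prob_measure_cantor :: "(nat \<Rightarrow> bool) measure \<Rightarrow> bool" where
  "prob_measure_cantor \<mu> \<longleftrightarrow> prob_space \<mu> \<and> sets \<mu> = sets cantor"

definition mu :: "(nat \<Rightarrow> bool) measure \<Rightarrow> bool list \<Rightarrow> real" where
  "mu \<mu> \<sigma> = measure \<mu> (cyl \<sigma>)"

definition computable_measure :: "(nat \<Rightarrow> bool) measure \<Rightarrow> bool" where
  "computable_measure \<mu> \<longleftrightarrow>
    (\<exists>r. \<forall>\<sigma> k. \<exists>v. eval r [str_code \<sigma>, k] v \<and> \<bar>rat_code v - mu \<mu> \<sigma>\<bar> \<le> (1/2) ^ k)"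

definition martingale :: "(nat \<Rightarrow> bool) measure \<Rightarrow> (bool list \<Rightarrow> real option) \<Rightarrow> bool" where
  "martingale \<mu> M \<longleftrightarrow>
    (\<forall>\<sigma> v. M \<sigma> = Some v \<longrightarrow> v \<ge> 0) \<and>
    (\<forall>\<sigma>. mu \<mu> \<sigma> > 0 \<longrightarrow> M \<sigma> \<noteq> None) \<and>
    (\<forall>\<sigma>. (let t = (\<lambda>\<tau>. if mu \<mu> \<tau> = 0 then 0 else the (M \<tau>) * mu \<mu> \<tau>)
          in t (\<sigma> @ [False]) + t (\<sigma> @ [True]) = t \<sigma>))"

definition computable_mart :: "(bool list \<Rightarrow> real option) \<Rightarrow> bool" where
  "computable_mart M \<longleftrightarrow>
    (\<exists>r. \<forall>\<sigma>. (case M \<sigma> of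
         None \<Rightarrow> (\<forall>k v. \<not> eval r [str_code \<sigma>, k] v)
       | Some x \<Rightarrow> (\<forall>k. \<exists>v. eval r [str_code \<sigma>, k] v \<and> \<bar>rat_code v - x\<bar> \<le> (1/2) ^ k)))"

definition total_mart :: "(bool list \<Rightarrow> real option) \<Rightarrow> bool" where
  "total_mart M \<longleftrightarrow> (\<forall>\<sigma>. M \<sigma> \<noteq> None)"

definition succeeds :: "(bool list \<Rightarrow> real option) \<Rightarrow> (nat \<Rightarrow> bool) \<Rightarrow> bool" where
  "succeeds M X \<longleftrightarrow> (\<forall>C::real. \<forall>N. \<exists>n\<ge>N. \<exists>v. M (prefix X n) = Some v \<and> v > C)"

definition computably_random :: "(nat \<Rightarrow> bool) measure \<Rightarrow> (nat \<Rightarrow> bool) \<Rightarrow> bool" where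
  "computably_random \<mu> X \<longleftrightarrow>
    \<not> (\<exists>M. martingale \<mu> M \<and> computable_mart M \<and> succeeds M X)"

end

(*
  X and mu are built from blocks of three bits (b, a, c).  At the end of a block the prefix tau
  names, through its a-bits, a finite set of programs that X claims to be total martingales.  Only
  a portion 2^-T of the mass goes on below tau (c = 0), where T is the time needed to run these
  programs on tau and on the two possible next blocks; the rest goes to c = 1.  So when mu first
  gives tau positive mass, the values of the claimed martingales one block ahead are known.  If one
  of them is visibly larger at a next block tau' than at tau, mu moves all mass of tau to tau', and
  a martingale would have to be constant there: the claim is false.  Otherwise the bits b and a are
  fair.  A partial martingale may wait for T and doubles its capital by betting on b = 0.  Along the
  X whose claims are exactly the true ones, T is always finite, the forced case never occurs, and
  each total computable martingale grows by at most 4 / 2^i over the i-th block, so it stays bounded.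
*)
theory Submission
  imports Defs
begin

section \<open>Computable functions\<close>

text \<open>Which programs compute total martingales is undecidable, so \<open>\<mu>\<close> must
  not depend on it: strings merely claim it, and the truth of claims is used only to choose X. A
  false claim may leave T infinite, which is undecidable too. The choice of 2^-T keeps
  \<open>\<mu>\<close> computable: if the runs have not halted by time k, taking 0 for this portion
  costs at most 2^-k. Below the exit c = True no waiting is required, so such an error occurs at
  most once along a string. Total and partial martingales differ in the order of commitment. A total
  one has values at the next blocks before \<open>\<mu>\<close> decides how to treat them; the
  gambler reads that decision first and is undefined where it never comes, which happens on null
  strings only. The bit b is there to be bet on. The bit a of X is a truth that \<open>\<mu>\<close>
  cannot know, hence the next blocks for both values of a are tested. Programs enter the test one
  per block and the tolerance shrinks with the block number, so gains that escape the test are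
  summable.\<close>

inductive_cases eval_ZeroE: "eval Zero xs z"
inductive_cases eval_SucE: "eval SucF xs z"
inductive_cases eval_ProjE: "eval (Proj i) xs z"
inductive_cases eval_CompE: "eval (Comp f gs) xs z"
inductive_cases eval_Prim0E: "eval (Prim f g) (0 # xs) z"
inductive_cases eval_PrimSE: "eval (Prim f g) (Suc n # xs) z"
inductive_cases eval_MuE: "eval (Mu f) xs z"

lemma eval_det: "eval f xs y \<Longrightarrow> eval f xs z \<Longrightarrow> y = z"
proof (induction arbitrary: z rule: eval.induct)
  case (eval_Zero xs)
  then show ?case by (elim eval_ZeroE) simp
next
  case (eval_Suc x xs)
  then show ?case by (elim eval_SucE) simp
next
  case (eval_Proj i xs)
  from eval_Proj.prems show ?case by (elim eval_ProjE) simp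
next
  case (eval_Comp xs gs ys f w)
  from eval_Comp.prems obtain ys' where ys': "list_all2 (\<lambda>g y. eval g xs y) gs ys'" "eval f ys' z"
    by (elim eval_CompE)
  have "ys = ys'"
    using eval_Comp.IH(1) ys'(1)
    by (simp add: list_all2_conv_all_nth) (metis nth_equalityI)
  then show ?case using ys'(2) eval_Comp.IH(2) by blast
next
  case (eval_Prim0 f xs y g)
  from eval_Prim0.prems show ?case
    by (elim eval_Prim0E) (rule eval_Prim0.IH)
next
  case (eval_PrimS f g n xs y w)
  from eval_PrimS.prems obtain y' where "eval (Prim f g) (n # xs) y'" "eval g (n # y' # xs) z"
    by (elim eval_PrimSE)
  then show ?case using eval_PrimS.IH(2)[of z] eval_PrimS.IH(1)[of y'] by simp
next
  case (eval_Mu f n xs)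
  from eval_Mu.prems obtain "eval f (z # xs) 0" "\<forall>m<z. \<exists>y. eval f (m # xs) (Suc y)"
    by (elim eval_MuE)
  note z = this
  show ?case
  proof (cases n z rule: linorder_cases)
    case less
    then obtain y where "eval f (n # xs) (Suc y)" using z(2) by blast
    then have "0 = Suc y" by (rule eval_Mu.IH(1))
    then show ?thesis by simp
  next
    case greater
    then obtain y where "eval f (z # xs) 0 \<longrightarrow> Suc y = 0" using eval_Mu.IH(2) by blast
    then show ?thesis using z(1) by simp
  qed simp
qed

section \<open>Closure properties of total computable functions of at most three arguments\<close>

definition rec1 :: "(nat \<Rightarrow> nat) \<Rightarrow> bool" where
  "rec1 f \<longleftrightarrow> (\<exists>r. \<forall>x. eval r [x] (f x))"

definition rec2 :: "(nat \<Rightarrow> nat \<Rightarrow> nat) \<Rightarrow> bool" where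
  "rec2 f \<longleftrightarrow> (\<exists>r. \<forall>x y. eval r [x, y] (f x y))"

definition rec3 :: "(nat \<Rightarrow> nat \<Rightarrow> nat \<Rightarrow> nat) \<Rightarrow> bool" where
  "rec3 f \<longleftrightarrow> (\<exists>r. \<forall>x y z. eval r [x, y, z] (f x y z))"

lemma eval_Proj_nth: "i < length xs \<Longrightarrow> xs ! i = y \<Longrightarrow> eval (Proj i) xs y"
  using eval_Proj by blast

lemma eval_Comp1: "eval g xs y \<Longrightarrow> eval f [y] z \<Longrightarrow> eval (Comp f [g]) xs z"
  by (rule eval_Comp[of _ _ "[y]"]) auto

lemma eval_Comp2:
  "eval g xs y \<Longrightarrow> eval h xs y' \<Longrightarrow> eval f [y, y'] z \<Longrightarrow> eval (Comp f [g, h]) xs z"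
  by (rule eval_Comp[of _ _ "[y, y']"]) auto

lemma rec1_id: "rec1 (\<lambda>x. x)"
  unfolding rec1_def by (rule exI[of _ "Proj 0"]) (auto intro: eval_Proj_nth)

lemma rec1_const: "rec1 (\<lambda>x. c)"
proof (induction c)
  case 0
  show ?case unfolding rec1_def by (rule exI[of _ Zero]) (auto intro: eval_Zero)
next
  case (Suc c)
  then obtain r where "\<forall>x. eval r [x] c" unfolding rec1_def by blast
  then show ?case unfolding rec1_def
    by (intro exI[of _ "Comp SucF [r]"]) (auto intro: eval_Comp1 eval_Suc)
qed

lemma rec1_comp:
  assumes "rec1 f" "rec1 g"
  shows "rec1 (\<lambda>x. f (g x))"
proof -
  from assms obtain p q where "\<And>x. eval p [x] (f x)" "\<And>x. eval q [x] (g x)"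
    unfolding rec1_def by blast
  then show ?thesis
    unfolding rec1_def by (intro exI[of _ "Comp p [q]"]) (blast intro: eval_Comp1)
qed

lemma rec1_rec2:
  assumes "rec2 h" "rec1 f" "rec1 g"
  shows "rec1 (\<lambda>x. h (f x) (g x))"
proof -
  from assms obtain p q r where "\<And>x y. eval p [x, y] (h x y)"
    "\<And>x. eval q [x] (f x)" "\<And>x. eval r [x] (g x)"
    unfolding rec1_def rec2_def by blast
  then show ?thesis
    unfolding rec1_def by (intro exI[of _ "Comp p [q, r]"]) (blast intro: eval_Comp2)
qed

lemma rec2_comp1:
  assumes "rec1 h" "rec2 f"
  shows "rec2 (\<lambda>x y. h (f x y))"
proof -
  from assms obtain p q where "\<And>x. eval p [x] (h x)" "\<And>x y. eval q [x, y] (f x y)"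
    unfolding rec1_def rec2_def by blast
  then show ?thesis
    unfolding rec2_def by (intro exI[of _ "Comp p [q]"]) (blast intro: eval_Comp1)
qed

lemma rec2_comp2:
  assumes "rec2 h" "rec2 f" "rec2 g"
  shows "rec2 (\<lambda>x y. h (f x y) (g x y))"
proof -
  from assms obtain p q r where "\<And>x y. eval p [x, y] (h x y)"
    "\<And>x y. eval q [x, y] (f x y)" "\<And>x y. eval r [x, y] (g x y)"
    unfolding rec2_def by blast
  then show ?thesis
    unfolding rec2_def by (intro exI[of _ "Comp p [q, r]"]) (blast intro: eval_Comp2)
qed

lemma rec3_comp1:
  assumes "rec1 h" "rec3 f"
  shows "rec3 (\<lambda>x y z. h (f x y z))"
proof -
  from assms obtain p q where "\<And>x. eval p [x] (h x)" "\<And>x y z. eval q [x, y, z] (f x y z)"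
    unfolding rec1_def rec3_def by blast
  then show ?thesis
    unfolding rec3_def by (intro exI[of _ "Comp p [q]"]) (blast intro: eval_Comp1)
qed

lemma rec3_comp2:
  assumes "rec2 h" "rec3 f" "rec3 g"
  shows "rec3 (\<lambda>x y z. h (f x y z) (g x y z))"
proof -
  from assms obtain p q r where "\<And>x y. eval p [x, y] (h x y)"
    "\<And>x y z. eval q [x, y, z] (f x y z)" "\<And>x y z. eval r [x, y, z] (g x y z)"
    unfolding rec2_def rec3_def by blast
  then show ?thesis
    unfolding rec3_def by (intro exI[of _ "Comp p [q, r]"]) (blast intro: eval_Comp2)
qed

lemma rec2_proj: "rec2 (\<lambda>x y. x)" "rec2 (\<lambda>x y. y)"
  unfolding rec2_def
  by (rule exI[of _ "Proj 0"], simp add: eval_Proj_nth) (rule exI[of _ "Proj 1"], simp add: eval_Proj_nth)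

lemma rec3_proj: "rec3 (\<lambda>x y z. x)" "rec3 (\<lambda>x y z. y)" "rec3 (\<lambda>x y z. z)"
  unfolding rec3_def
  by (rule exI[of _ "Proj 0"], simp add: eval_Proj_nth) (rule exI[of _ "Proj 1"], simp add: eval_Proj_nth,
      rule exI[of _ "Proj 2"], simp add: eval_Proj_nth)

lemma rec1_Suc: "rec1 Suc"
  unfolding rec1_def by (auto intro: eval_Suc)

lemma rec2_prim:
  assumes "rec1 f" and "rec3 g"
  shows "rec2 (\<lambda>n x. rec_nat (f x) (\<lambda>i y. g i y x) n)"
proof -
  from assms obtain rf rg where f: "\<And>x. eval rf [x] (f x)" and g: "\<And>i y x. eval rg [i, y, x] (g i y x)"
    unfolding rec1_def rec3_def by blast
  have "eval (Prim rf rg) [n, x] (rec_nat (f x) (\<lambda>i y. g i y x) n)" for n x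
    by (induction n) (auto intro: eval_Prim0 f eval_PrimS g)
  then show ?thesis unfolding rec2_def by blast
qed

lemma rec1_prim:
  assumes "rec2 g"
  shows "rec1 (\<lambda>n. rec_nat c g n)"
proof -
  have "rec3 (\<lambda>i y x. g i y)" by (rule rec3_comp2[OF assms rec3_proj(1,2)])
  from rec1_rec2[OF rec2_prim[OF rec1_const this] rec1_id rec1_id] show ?thesis .
qed

lemma rec2_add: "rec2 (+)"
proof -
  have "rec2 (\<lambda>n x. rec_nat x (\<lambda>i y. Suc y) n)"
    by (intro rec2_prim rec1_id rec3_comp1[OF rec1_Suc] rec3_proj)
  moreover have "rec_nat x (\<lambda>i y. Suc y) n = n + x" for n x by (induction n) auto
  ultimately show ?thesis by simp
qed

lemma rec2_mult: "rec2 (*)"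
proof -
  have "rec2 (\<lambda>n x. rec_nat 0 (\<lambda>i y. y + x) n)"
    by (intro rec2_prim rec1_const rec3_comp2[OF rec2_add] rec3_proj)
  moreover have "rec_nat 0 (\<lambda>i y. y + x) n = n * x" for n x by (induction n) auto
  ultimately show ?thesis by simp
qed

lemma rec1_pred: "rec1 (\<lambda>n. n - 1)"
proof -
  have "rec1 (\<lambda>n. rec_nat 0 (\<lambda>i y. i) n)"
    by (intro rec1_prim rec2_proj)
  moreover have "rec_nat 0 (\<lambda>i y. i) n = n - 1" for n by (cases n) auto
  ultimately show ?thesis by simp
qed

lemma rec2_diff: "rec2 (-)"
proof -
  have "rec2 (\<lambda>n x. rec_nat x (\<lambda>i y. y - 1) n)"
    by (intro rec2_prim rec1_id rec3_comp1[OF rec1_pred] rec3_proj)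
  moreover have "rec_nat x (\<lambda>i y. y - 1) n = x - n" for n x by (induction n) auto
  ultimately have "rec2 (\<lambda>n x. x - n)" by simp
  from rec2_comp2[OF this rec2_proj(2) rec2_proj(1)] show ?thesis by simp
qed

lemma rec1_triangle: "rec1 triangle"
proof -
  have "rec1 (\<lambda>n. rec_nat 0 (\<lambda>i y. y + Suc i) n)"
    by (intro rec1_prim rec2_comp2[OF rec2_add] rec2_comp1[OF rec1_Suc] rec2_proj)
  moreover have "rec_nat 0 (\<lambda>i y. y + Suc i) n = triangle n" for n by (induction n) auto
  ultimately show ?thesis by simp
qed

section \<open>Decoding Cantor pairs\<close>

abbreviation pair :: "nat \<Rightarrow> nat \<Rightarrow> nat" where
  "pair a b \<equiv> prod_encode (a, b)"

definition pfst :: "nat \<Rightarrow> nat" where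
  "pfst n = fst (prod_decode n)"

definition psnd :: "nat \<Rightarrow> nat" where
  "psnd n = snd (prod_decode n)"

lemma pfst_pair [simp]: "pfst (pair a b) = a" and psnd_pair [simp]: "psnd (pair a b) = b"
  by (simp_all add: pfst_def psnd_def)

lemma rec2_pair: "rec2 pair"
  unfolding prod_encode_def
  by (simp, intro rec2_comp2[OF rec2_add] rec2_comp1[OF rec1_triangle] rec2_proj)

text \<open>The diagonal of \<open>n\<close> in Cantor's enumeration: subtracting its triangle number decodes the pair.\<close>

definition diagonal :: "nat \<Rightarrow> nat" where
  "diagonal = rec_nat 0 (\<lambda>i y. y + (1 - (triangle (Suc y) - Suc i)))"

lemma triangle_mono: "a \<le> b \<Longrightarrow> triangle a \<le> triangle b"
  by (induction rule: dec_induct) auto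

text \<open>One step passes at most one triangle number. With truncated subtraction, the increment
  \<open>1 - (triangle (Suc y) - Suc i)\<close> is 1 if \<open>triangle (Suc y)\<close> has been
  reached and 0 otherwise.\<close>

lemma diagonal_bounds: "triangle (diagonal n) \<le> n \<and> n < triangle (Suc (diagonal n))"
proof (induction n)
  case (Suc n)
  then show ?case
    by (cases "triangle (Suc (diagonal n)) \<le> Suc n") (auto simp: diagonal_def)
qed (simp add: diagonal_def)

lemma diagonal_unique:
  assumes "triangle r \<le> n" "n < triangle (Suc r)"
  shows "diagonal n = r"
proof (rule ccontr)
  assume "diagonal n \<noteq> r"
  then consider "Suc (diagonal n) \<le> r" | "Suc r \<le> diagonal n" by linarith
  then show False
    using diagonal_bounds[of n] assms triangle_mono by cases (meson leD le_trans)+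
qed

lemma pfst_eq: "pfst n = n - triangle (diagonal n)"
  and psnd_eq: "psnd n = diagonal n - (n - triangle (diagonal n))"
proof -
  obtain a b where n: "n = pair a b" by (metis prod_decode_inverse surj_pair)
  have "diagonal n = a + b"
    by (rule diagonal_unique) (auto simp: n prod_encode_def)
  then show "pfst n = n - triangle (diagonal n)" "psnd n = diagonal n - (n - triangle (diagonal n))"
    by (simp_all add: n) (simp_all add: prod_encode_def)
qed

lemma rec1_diagonal: "rec1 diagonal"
  unfolding diagonal_def
  by (intro rec1_prim rec2_comp2[OF rec2_add] rec2_comp2[OF rec2_diff] rec2_comp1[OF rec1_triangle]
      rec2_comp1[OF rec1_Suc] rec2_comp1[OF rec1_const rec2_proj(1)] rec2_proj)

lemma rec1_pfst: "rec1 pfst"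
  unfolding pfst_eq[abs_def]
  by (intro rec1_rec2[OF rec2_diff] rec1_comp[OF rec1_triangle] rec1_diagonal rec1_id)

lemma rec1_psnd: "rec1 psnd"
  unfolding psnd_eq[abs_def]
  by (intro rec1_rec2[OF rec2_diff] rec1_comp[OF rec1_triangle] rec1_diagonal rec1_id)

section \<open>Unary functions with packed arguments, computable predicates, bounded search\<close>

named_theorems rec_intros

definition recP :: "(nat \<Rightarrow> bool) \<Rightarrow> bool" where
  "recP P \<longleftrightarrow> rec1 (\<lambda>x. of_bool (P x))"

lemma rec1_basic [rec_intros]:
  "rec1 (\<lambda>x. x)" "rec1 (\<lambda>x. c)"
  "rec1 f \<Longrightarrow> rec1 (\<lambda>x. Suc (f x))"
  "rec1 f \<Longrightarrow> rec1 (\<lambda>x. pfst (f x))"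
  "rec1 f \<Longrightarrow> rec1 (\<lambda>x. psnd (f x))"
  "rec1 f \<Longrightarrow> rec1 g \<Longrightarrow> rec1 (\<lambda>x. pair (f x) (g x))"
  "rec1 f \<Longrightarrow> rec1 g \<Longrightarrow> rec1 (\<lambda>x. f x + g x)"
  "rec1 f \<Longrightarrow> rec1 g \<Longrightarrow> rec1 (\<lambda>x. f x * g x)"
  "rec1 f \<Longrightarrow> rec1 g \<Longrightarrow> rec1 (\<lambda>x. f x - g x)"
  by (intro rec1_id rec1_const rec1_comp[OF rec1_Suc] rec1_comp[OF rec1_pfst]
      rec1_comp[OF rec1_psnd] rec1_rec2[OF rec2_pair] rec1_rec2[OF rec2_add]
      rec1_rec2[OF rec2_mult] rec1_rec2[OF rec2_diff]; assumption)+

text \<open>The step function receives parameter, index and value packed into one number, so its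
  computability is again a goal about a unary function that \<open>rec_intros\<close> can
  handle.\<close>

lemma rec1_rec_nat:
  assumes g: "rec1 (\<lambda>z. g (pfst z) (pfst (psnd z)) (psnd (psnd z)))" and "rec1 a" "rec1 n"
  shows "rec1 (\<lambda>x. rec_nat (a x) (\<lambda>i y. g x i y) (n x))"
proof -
  have "rec3 (\<lambda>i y x. pair x (pair i y))"
    by (intro rec3_comp2[OF rec2_pair] rec3_proj)
  from rec3_comp1[OF g this] have "rec3 (\<lambda>i y x. g x i y)" by simp
  from rec1_rec2[OF rec2_prim[OF assms(2) this] assms(3) rec1_id] show ?thesis .
qed

lemma recP_comp: "recP P \<Longrightarrow> rec1 f \<Longrightarrow> recP (\<lambda>x. P (f x))"
  unfolding recP_def using rec1_comp by blast

lemma recP_eq_0 [rec_intros]: "rec1 f \<Longrightarrow> recP (\<lambda>x. f x = 0)"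
proof -
  assume "rec1 f"
  then have "rec1 (\<lambda>x. 1 - f x)" by (intro rec_intros)
  moreover have "(\<lambda>x. 1 - f x) = (\<lambda>x. of_bool (f x = 0))" by auto
  ultimately show ?thesis unfolding recP_def by simp
qed

lemma recP_const [rec_intros]: "recP (\<lambda>x. b)"
  unfolding recP_def by (rule rec_intros)

lemma recP_not [rec_intros]: "recP P \<Longrightarrow> recP (\<lambda>x. \<not> P x)"
  using recP_eq_0[of "\<lambda>x. of_bool (P x)"] unfolding recP_def by simp

lemma recP_conj [rec_intros]: "recP P \<Longrightarrow> recP Q \<Longrightarrow> recP (\<lambda>x. P x \<and> Q x)"
  unfolding recP_def of_bool_conj by (intro rec_intros)

lemma recP_disj [rec_intros]: "recP P \<Longrightarrow> recP Q \<Longrightarrow> recP (\<lambda>x. P x \<or> Q x)"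
  using recP_not[OF recP_conj[OF recP_not recP_not], of P Q] by simp

lemma recP_imp [rec_intros]: "recP P \<Longrightarrow> recP Q \<Longrightarrow> recP (\<lambda>x. P x \<longrightarrow> Q x)"
  unfolding imp_conv_disj by (intro rec_intros)

lemma recP_le [rec_intros]: "rec1 f \<Longrightarrow> rec1 g \<Longrightarrow> recP (\<lambda>x. f x \<le> g x)"
  using recP_eq_0[of "\<lambda>x. f x - g x"] rec1_basic(9)[of f g] by simp

lemma recP_less [rec_intros]: "rec1 f \<Longrightarrow> rec1 g \<Longrightarrow> recP (\<lambda>x. f x < g x)"
  unfolding less_eq_Suc_le by (intro rec_intros)

lemma recP_eq [rec_intros]: "rec1 f \<Longrightarrow> rec1 g \<Longrightarrow> recP (\<lambda>x. f x = g x)"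
  unfolding eq_iff by (intro rec_intros)

lemma rec1_if [rec_intros]:
  assumes "recP P" "rec1 f" "rec1 g"
  shows "rec1 (\<lambda>x. if P x then f x else g x)"
proof -
  have "(\<lambda>x. if P x then f x else g x) = (\<lambda>x. of_bool (P x) * f x + (1 - of_bool (P x)) * g x)"
    by auto
  with assms show ?thesis unfolding recP_def by (simp, intro rec_intros)
qed

lemma recP_all:
  assumes "recP (\<lambda>y. P (pfst y) (psnd y))" "rec1 n"
  shows "recP (\<lambda>x. \<forall>j<n x. P x j)"
proof -
  let ?g = "\<lambda>x j b. b * (of_bool (P x j) :: nat)"
  have "rec1 (\<lambda>z. of_bool (P (pfst z) (pfst (psnd z))) :: nat)"
    using recP_comp[OF assms(1), of "\<lambda>z. pair (pfst z) (pfst (psnd z))"]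
    unfolding recP_def by (simp add: rec_intros)
  then have "rec1 (\<lambda>x. rec_nat 1 (\<lambda>j b. ?g x j b) (n x))"
    by (intro rec1_rec_nat rec_intros assms(2))
  moreover have "rec_nat 1 (\<lambda>j b. ?g x j b) k = of_bool (\<forall>j<k. P x j)" for x k
    by (induction k) (auto simp: less_Suc_eq)
  ultimately show ?thesis unfolding recP_def by simp
qed

lemma recP_ex:
  assumes "recP (\<lambda>y. P (pfst y) (psnd y))" "rec1 n"
  shows "recP (\<lambda>x. \<exists>j<n x. P x j)"
  using recP_not[OF recP_all[OF recP_not[OF assms(1)] assms(2)]] by simp

lemma rec1_sum:
  assumes "rec1 (\<lambda>y. f (pfst y) (psnd y))" "rec1 n"
  shows "rec1 (\<lambda>x. \<Sum>j<n x. f x j)"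
proof -
  have "rec1 (\<lambda>z. f (pfst z) (pfst (psnd z)))"
    using rec1_comp[OF assms(1), of "\<lambda>z. pair (pfst z) (pfst (psnd z))"]
    by (simp add: rec_intros)
  then have "rec1 (\<lambda>x. rec_nat 0 (\<lambda>j b. b + f x j) (n x))"
    by (intro rec1_rec_nat rec_intros assms(2))
  moreover have "rec_nat 0 (\<lambda>j b. b + f x j) k = (\<Sum>j<k. f x j)" for x k
    by (induction k) auto
  ultimately show ?thesis by simp
qed

lemma rec1_prod:
  assumes "rec1 (\<lambda>y. f (pfst y) (psnd y))" "rec1 n"
  shows "rec1 (\<lambda>x. \<Prod>j<n x. f x j)"
proof -
  have "rec1 (\<lambda>z. f (pfst z) (pfst (psnd z)))"
    using rec1_comp[OF assms(1), of "\<lambda>z. pair (pfst z) (pfst (psnd z))"]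
    by (simp add: rec_intros)
  then have "rec1 (\<lambda>x. rec_nat 1 (\<lambda>j b. b * f x j) (n x))"
    by (intro rec1_rec_nat rec_intros assms(2))
  moreover have "rec_nat 1 (\<lambda>j b. b * f x j) k = (\<Prod>j<k. f x j)" for x k
    by (induction k) auto
  ultimately show ?thesis by simp
qed

lemma rec1_Least:
  assumes "recP (\<lambda>y. P (pfst y) (psnd y))" "rec1 n"
  shows "rec1 (\<lambda>x. LEAST j. P x j \<or> n x \<le> j)"
proof -
  \<comment> \<open>The counter \<open>y\<close> keeps pace with the index \<open>j\<close> as long
    as every test fails; at the first success it falls behind and is frozen from then on.\<close>
  let ?g = "\<lambda>x j y. if y = j \<and> \<not> P x j then Suc j else y"
  have "recP (\<lambda>z. P (pfst z) (pfst (psnd z)))"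
    using recP_comp[OF assms(1), of "\<lambda>z. pair (pfst z) (pfst (psnd z))"]
    by (simp add: rec_intros)
  then have "rec1 (\<lambda>x. rec_nat 0 (\<lambda>j y. ?g x j y) (n x))"
    by (intro rec1_rec_nat rec_intros assms(2))
  moreover define R where "R x = rec_nat 0 (\<lambda>j y. ?g x j y)" for x
  ultimately have "rec1 (\<lambda>x. R x (n x))" by simp
  moreover have R: "R x k \<le> k \<and> (R x k < k \<longrightarrow> P x (R x k)) \<and> (\<forall>j<R x k. \<not> P x j)" for x k
    by (induction k) (auto simp: R_def less_Suc_eq le_Suc_eq)
  have "(LEAST j. P x j \<or> k \<le> j) = R x k" for x k
  proof (rule Least_equality)
    show "P x (R x k) \<or> k \<le> R x k" using R[of x k] by linarith
    show "R x k \<le> j" if "P x j \<or> k \<le> j" for j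
      using that R[of x k] by (meson le_trans not_less)
  qed
  ultimately show ?thesis by simp
qed

lemma rec1_funpow:
  assumes "rec1 g" "rec1 a" "rec1 n"
  shows "rec1 (\<lambda>x. (g ^^ n x) (a x))"
proof -
  have "rec1 (\<lambda>x. rec_nat (a x) (\<lambda>i y. g y) (n x))"
    by (rule rec1_rec_nat) (intro rec1_comp[OF assms(1)] rec_intros assms)+
  moreover have "rec_nat y (\<lambda>i y. g y) k = (g ^^ k) y" for y k by (induction k) auto
  ultimately show ?thesis by simp
qed

lemma rec1_pow2 [rec_intros]:
  assumes "rec1 f"
  shows "rec1 (\<lambda>x. 2 ^ f x)"
proof -
  have "rec1 (\<lambda>x. rec_nat 1 (\<lambda>i y. 2 * y) (f x))"
    by (intro rec1_rec_nat rec_intros assms)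
  moreover have "rec_nat 1 (\<lambda>i y. 2 * y) k = (2 ^ k :: nat)" for k by (induction k) auto
  ultimately show ?thesis by simp
qed

lemma rec1_mod [rec_intros]:
  assumes "rec1 f"
  shows "rec1 (\<lambda>x. f x mod n)"
proof -
  have "rec1 (\<lambda>x. rec_nat 0 (\<lambda>i y. if Suc y = n then 0 else Suc y) (f x))"
    by (intro rec1_rec_nat rec_intros assms)
  moreover have "rec_nat 0 (\<lambda>i y. if Suc y = n then 0 else Suc y) k = k mod n" for k
    by (induction k) (auto simp: mod_Suc)
  ultimately show ?thesis by simp
qed

lemma rec1_div [rec_intros]:
  assumes "rec1 f"
  shows "rec1 (\<lambda>x. f x div n)"
proof -
  have "rec1 (\<lambda>x. rec_nat 0 (\<lambda>i y. if Suc i mod n = 0 then Suc y else y) (f x))"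
    by (intro rec1_rec_nat rec_intros assms)
  moreover have "rec_nat 0 (\<lambda>i y. if Suc i mod n = 0 then Suc y else y) k = k div n" for k
    by (induction k) (auto simp: div_Suc)
  ultimately show ?thesis by simp
qed

section \<open>A universal machine\<close>

definition lhd :: "nat \<Rightarrow> nat" where "lhd c = pfst (c - 1)"

definition ltl :: "nat \<Rightarrow> nat" where "ltl c = psnd (c - 1)"

definition lcons :: "nat \<Rightarrow> nat \<Rightarrow> nat" where "lcons a c = Suc (pair a c)"

lemma lcons_simps [simp]:
  "lhd (lcons a c) = a" "ltl (lcons a c) = c" "lcons a c \<noteq> 0"
  by (simp_all add: lhd_def ltl_def lcons_def)

lemma list_encode_lcons: "list_encode (x # xs) = lcons x (list_encode xs)"
  by (simp add: lcons_def)

lemma funpow_ltl: "i \<le> length xs \<Longrightarrow> (ltl ^^ i) (list_encode xs) = list_encode (drop i xs)"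
proof (induction i)
  case (Suc i)
  then show ?case
    by (simp add: list_encode_lcons Cons_nth_drop_Suc[symmetric] del: list_encode.simps)
qed simp

lemma lhd_funpow_ltl: "i < length xs \<Longrightarrow> lhd ((ltl ^^ i) (list_encode xs)) = xs ! i"
  by (simp add: funpow_ltl list_encode_lcons Cons_nth_drop_Suc[symmetric] del: list_encode.simps)

lemma rec1_list [rec_intros]:
  "rec1 f \<Longrightarrow> rec1 (\<lambda>x. lhd (f x))"
  "rec1 f \<Longrightarrow> rec1 (\<lambda>x. ltl (f x))"
  "rec1 f \<Longrightarrow> rec1 g \<Longrightarrow> rec1 (\<lambda>x. lcons (f x) (g x))"
  "rec1 f \<Longrightarrow> rec1 g \<Longrightarrow> rec1 (\<lambda>x. (ltl ^^ f x) (g x))"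
proof -
  show ltl: "rec1 f \<Longrightarrow> rec1 (\<lambda>x. ltl (f x))" for f
    unfolding ltl_def by (intro rec_intros)
  show "rec1 f \<Longrightarrow> rec1 (\<lambda>x. lhd (f x))"
    "rec1 f \<Longrightarrow> rec1 g \<Longrightarrow> rec1 (\<lambda>x. lcons (f x) (g x))"
    unfolding lhd_def lcons_def by (intro rec_intros; assumption)+
  show "rec1 f \<Longrightarrow> rec1 g \<Longrightarrow> rec1 (\<lambda>x. (ltl ^^ f x) (g x))"
    by (rule rec1_funpow[OF ltl[OF rec1_id]])
qed

fun recf_code :: "recf \<Rightarrow> nat" where
  "recf_code Zero = pair 0 0"
| "recf_code SucF = pair 1 0"
| "recf_code (Proj i) = pair 2 i"
| "recf_code (Comp f gs) = pair 3 (pair (recf_code f) (list_encode (map recf_code gs)))"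
| "recf_code (Prim f g) = pair 4 (pair (recf_code f) (recf_code g))"
| "recf_code (Mu f) = pair 5 (recf_code f)"

text \<open>
  A stack machine on numbers: mode 0 evaluates the program \<open>a\<close> on the argument list \<open>b\<close>, mode 1
  evaluates the list \<open>a\<close> of programs on \<open>b\<close>, and mode 2 returns the value \<open>a\<close> to the topmost frame
  of the stack \<open>K\<close>.
\<close>

definition st :: "nat \<Rightarrow> nat \<Rightarrow> nat \<Rightarrow> nat \<Rightarrow> nat" where
  "st m a b K = pair m (pair a (pair b K))"

definition push :: "nat \<Rightarrow> nat \<Rightarrow> nat \<Rightarrow> nat \<Rightarrow> nat" where
  "push t u w K = lcons (pair t (pair u w)) K"

definition step_eval :: "nat \<Rightarrow> nat \<Rightarrow> nat \<Rightarrow> nat" where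
  "step_eval a b K =
    (let t = pfst a; u = psnd a in
     if t = 0 then st 2 0 0 K
     else if t = 1 then st 2 (Suc (lhd b)) 0 K
     else if t = 2 then st 2 (lhd ((ltl ^^ u) b)) 0 K
     else if t = 3 then st 1 (psnd u) b (push 0 (pfst u) 0 K)
     else if t = 4 then
       (if lhd b = 0 then st 0 (pfst u) (ltl b) K
        else st 0 a (lcons (lhd b - 1) (ltl b)) (push 3 (psnd u) (lcons (lhd b - 1) (ltl b)) K))
     else st 0 u (lcons 0 b) (push 4 u (lcons 0 b) K))"

definition step_args :: "nat \<Rightarrow> nat \<Rightarrow> nat \<Rightarrow> nat" where
  "step_args a b K = (if a = 0 then st 2 0 0 K else st 1 (ltl a) b (push 1 (lhd a) b K))"

text \<open>Frame 0 applies the program \<open>u\<close> to the returned argument list; 1 and 2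
  evaluate the head of a program list after its tail and cons the two results; 3 feeds a recursive
  value to the step program of a primitive recursion; 4 tests a candidate of a minimization. On the
  empty stack 0 the returned value is kept forever.\<close>

definition step_return :: "nat \<Rightarrow> nat \<Rightarrow> nat" where
  "step_return v K =
    (if K = 0 then st 2 v 0 K
     else let t = pfst (lhd K); u = pfst (psnd (lhd K)); w = psnd (psnd (lhd K)); K' = ltl K in
       if t = 0 then st 0 u v K'
       else if t = 1 then st 0 u w (push 2 v 0 K')
       else if t = 2 then st 2 (lcons v u) 0 K'
       else if t = 3 then st 0 u (lcons (lhd w) (lcons v (ltl w))) K'
       else if v = 0 then st 2 (lhd w) 0 K'
       else st 0 u (lcons (Suc (lhd w)) (ltl w)) (push 4 u (lcons (Suc (lhd w)) (ltl w)) K'))"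

definition mstep :: "nat \<Rightarrow> nat" where
  "mstep s =
    (let a = pfst (psnd s); b = pfst (psnd (psnd s)); K = psnd (psnd (psnd s)) in
     if pfst s = 0 then step_eval a b K else if pfst s = 1 then step_args a b K else step_return a K)"

lemma mstep_st [simp]:
  "mstep (st 0 a b K) = step_eval a b K"
  "mstep (st (Suc 0) a b K) = step_args a b K"
  "mstep (st 2 a b K) = step_return a K"
  by (simp_all add: mstep_def st_def)

lemma step_return_push [simp]:
  "step_return v (push 0 u w K) = st 0 u v K"
  "step_return v (push (Suc 0) u w K) = st 0 u w (push 2 v 0 K)"
  "step_return v (push 2 u w K) = st 2 (lcons v u) 0 K"
  "step_return v (push 3 u w K) = st 0 u (lcons (lhd w) (lcons v (ltl w))) K"
  "step_return 0 (push 4 u w K) = st 2 (lhd w) 0 K"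
  "step_return (Suc v) (push 4 u w K) =
     st 0 u (lcons (Suc (lhd w)) (ltl w)) (push 4 u (lcons (Suc (lhd w)) (ltl w)) K)"
  by (simp_all add: step_return_def push_def)

lemma rec1_st: "rec1 m \<Longrightarrow> rec1 a \<Longrightarrow> rec1 b \<Longrightarrow> rec1 K \<Longrightarrow> rec1 (\<lambda>x. st (m x) (a x) (b x) (K x))"
  unfolding st_def by (intro rec_intros)

lemma rec1_push: "rec1 m \<Longrightarrow> rec1 a \<Longrightarrow> rec1 b \<Longrightarrow> rec1 K \<Longrightarrow> rec1 (\<lambda>x. push (m x) (a x) (b x) (K x))"
  unfolding push_def by (intro rec_intros)

lemma rec1_mstep: "rec1 mstep"
  unfolding mstep_def[abs_def] step_eval_def step_args_def step_return_def Let_def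
  by (intro rec_intros rec1_st rec1_push)

definition reaches :: "nat \<Rightarrow> nat \<Rightarrow> bool" where
  "reaches s t \<longleftrightarrow> (\<exists>n. (mstep ^^ n) s = t)"

lemma reaches_refl: "reaches s s"
  unfolding reaches_def by (rule exI[of _ 0]) simp

lemma reaches_trans: "reaches s t \<Longrightarrow> reaches t u \<Longrightarrow> reaches s u"
  unfolding reaches_def by (metis comp_apply funpow_add)

lemma reaches_step: "reaches (mstep s) t \<Longrightarrow> reaches s t"
  unfolding reaches_def by (metis comp_apply funpow_Suc_right)

text \<open>The premise is what the induction over \<open>eval\<close> supplies for the programs
  inside \<open>Comp\<close>. Evaluating the tail first lets frame 2 build the result list by
  consing.\<close>

lemma reaches_args:
  assumes "list_all2 (\<lambda>g y. \<forall>K. reaches (st 0 (recf_code g) b K) (st 2 y 0 K)) gs ys"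
  shows "reaches (st (Suc 0) (list_encode (map recf_code gs)) b K) (st 2 (list_encode ys) 0 K)"
  using assms
proof (induction arbitrary: K rule: list_all2_induct)
  case Nil
  show ?case by (rule reaches_step) (simp add: step_args_def reaches_refl)
next
  case (Cons g gs y ys)
  let ?K = "push 1 (recf_code g) b K"
  have "reaches (st (Suc 0) (list_encode (map recf_code gs)) b ?K) (st 2 (list_encode ys) 0 ?K)"
    by (rule Cons.IH)
  moreover have "reaches (st 2 (list_encode ys) 0 ?K)
      (st 0 (recf_code g) b (push 2 (list_encode ys) 0 K))"
    by (rule reaches_step) (simp add: reaches_refl)
  moreover have "reaches (st 0 (recf_code g) b (push 2 (list_encode ys) 0 K))
      (st 2 y 0 (push 2 (list_encode ys) 0 K))"
    using Cons.hyps by blast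
  moreover have "reaches (st 2 y 0 (push 2 (list_encode ys) 0 K)) (st 2 (list_encode (y # ys)) 0 K)"
    by (rule reaches_step) (simp add: reaches_refl lcons_def)
  ultimately have "reaches (st (Suc 0) (list_encode (map recf_code gs)) b ?K)
      (st 2 (list_encode (y # ys)) 0 K)"
    by (blast intro: reaches_trans)
  then show ?case
    by (intro reaches_step[of "st (Suc 0) _ _ _"])
      (simp add: step_args_def list_encode_lcons del: list_encode.simps)
qed

text \<open>The stack \<open>K\<close> is arbitrary because subcomputations run on top of the frames
  of their callers and must leave them intact.\<close>

lemma eval_reaches:
  "eval r xs v \<Longrightarrow> reaches (st 0 (recf_code r) (list_encode xs) K) (st 2 v 0 K)"
proof (induction arbitrary: K rule: eval.induct)
  case (eval_Zero xs)
  show ?case by (rule reaches_step) (simp add: step_eval_def Let_def reaches_refl)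
next
  case (eval_Suc x xs)
  show ?case
    by (rule reaches_step)
      (simp add: step_eval_def Let_def reaches_refl list_encode_lcons del: list_encode.simps)
next
  case (eval_Proj i xs)
  then show ?case
    by (intro reaches_step[of "st 0 _ _ _"])
      (simp add: step_eval_def Let_def reaches_refl lhd_funpow_ltl)
next
  case (eval_Comp xs gs ys f z)
  let ?K = "push 0 (recf_code f) 0 K"
  have "reaches (st (Suc 0) (list_encode (map recf_code gs)) (list_encode xs) ?K)
      (st 2 (list_encode ys) 0 ?K)"
    by (rule reaches_args) (use eval_Comp.IH(1) in \<open>auto elim: list_all2_mono\<close>)
  moreover have "reaches (st 2 (list_encode ys) 0 ?K) (st 0 (recf_code f) (list_encode ys) K)"
    by (rule reaches_step) (simp add: reaches_refl)
  ultimately have "reaches (st (Suc 0) (list_encode (map recf_code gs)) (list_encode xs) ?K) (st 2 z 0 K)"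
    using eval_Comp.IH(2) by (blast intro: reaches_trans)
  then show ?case
    by (intro reaches_step[of "st 0 _ _ _"]) (simp add: step_eval_def)
next
  case (eval_Prim0 f xs y g)
  then show ?case
    by (intro reaches_step[of "st 0 _ _ _"])
      (simp add: step_eval_def Let_def list_encode_lcons del: list_encode.simps)
next
  case (eval_PrimS f g n xs y z)
  let ?K = "push 3 (recf_code g) (list_encode (n # xs)) K"
  have "reaches (st 0 (recf_code (Prim f g)) (list_encode (n # xs)) ?K) (st 2 y 0 ?K)"
    by (rule eval_PrimS.IH(1))
  moreover have "reaches (st 2 y 0 ?K) (st 0 (recf_code g) (list_encode (n # y # xs)) K)"
    by (rule reaches_step)
      (simp add: reaches_refl list_encode_lcons del: list_encode.simps)
  ultimately have "reaches (st 0 (recf_code (Prim f g)) (list_encode (n # xs)) ?K) (st 2 z 0 K)"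
    using eval_PrimS.IH(2) by (blast intro: reaches_trans)
  then show ?case
    by (intro reaches_step[of "st 0 _ (list_encode (Suc n # xs)) _"])
      (simp add: step_eval_def Let_def list_encode_lcons del: list_encode.simps)
next
  case (eval_Mu f n xs)
  let ?K = "\<lambda>m. push 4 (recf_code f) (list_encode (m # xs)) K"
  let ?S = "\<lambda>m. st 0 (recf_code f) (list_encode (m # xs)) (?K m)"
  \<comment> \<open>Each candidate below \<open>n\<close> returns a successor, on which frame 4
    starts the next candidate.\<close>
  have "m \<le> n \<Longrightarrow> reaches (?S 0) (?S m)" for m
  proof (induction m)
    case (Suc m)
    then have "m < n" by simp
    then obtain y where "reaches (?S m) (st 2 (Suc y) 0 (?K m))"
      using eval_Mu.IH(2) by blast
    moreover have "reaches (st 2 (Suc y) 0 (?K m)) (?S (Suc m))"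
      by (rule reaches_step)
        (simp add: reaches_refl list_encode_lcons del: list_encode.simps)
    ultimately show ?case using Suc by (meson Suc_leD reaches_trans)
  qed (simp add: reaches_refl)
  then have "reaches (?S 0) (?S n)" by simp
  moreover have "reaches (?S n) (st 2 0 0 (?K n))" by (rule eval_Mu.IH(1))
  moreover have "reaches (st 2 0 0 (?K n)) (st 2 n 0 K)"
    by (rule reaches_step)
      (simp add: reaches_refl list_encode_lcons del: list_encode.simps)
  ultimately have "reaches (?S 0) (st 2 n 0 K)" by (blast intro: reaches_trans)
  then show ?case
    by (intro reaches_step[of "st 0 _ (list_encode xs) _"])
      (simp add: step_eval_def Let_def list_encode_lcons del: list_encode.simps)
qed

text \<open>The value 0 means that the machine has not halted after \<open>s\<close> steps.\<close>

definition run :: "nat \<Rightarrow> nat \<Rightarrow> nat \<Rightarrow> nat \<Rightarrow> nat" where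
  "run j x k s =
    (let t = (mstep ^^ s) (st 0 j (list_encode [x, k]) 0) in
     if pfst t = 2 \<and> psnd (psnd (psnd t)) = 0 then Suc (pfst (psnd t)) else 0)"

lemma rec1_run [rec_intros]:
  assumes "rec1 j" "rec1 x" "rec1 k" "rec1 s"
  shows "rec1 (\<lambda>z. run (j z) (x z) (k z) (s z))"
  unfolding run_def Let_def list_encode.simps
  by (intro rec_intros rec1_funpow rec1_mstep rec1_st assms)

lemma run_halted:
  assumes "run j x k s \<noteq> 0" "s \<le> s'"
  shows "run j x k s' = run j x k s"
proof -
  define out where "out t = (if pfst t = 2 \<and> psnd (psnd (psnd t)) = 0 then Suc (pfst (psnd t)) else 0)" for t
  define s0 where "s0 = st 0 j (list_encode [x, k]) 0"
  have run: "run j x k n = out ((mstep ^^ n) s0)" for n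
    by (simp only: run_def out_def s0_def Let_def)
  define t where "t = (mstep ^^ s) s0"
  have t: "pfst t = 2" "psnd (psnd (psnd t)) = 0"
    using assms(1) by (auto simp: run t_def out_def split: if_splits)
  \<comment> \<open>The register \<open>b\<close> of a halted state may be non-zero; one further
    step clears it without changing the output, and only the cleared state is a fixed point.\<close>
  define u where "u = st 2 (pfst (psnd t)) 0 0"
  have u: "mstep t = u" "mstep u = u"
    using t by (simp_all add: mstep_def step_return_def u_def st_def)
  have "out u = out t"
    using t by (simp add: out_def u_def st_def)
  have fin: "(mstep ^^ n) t = t \<or> (mstep ^^ n) t = u" for n
  proof (induction n)
    case (Suc n)
    then show ?case by (elim disjE) (simp_all add: u)
  qed simp
  have "(mstep ^^ s') s0 = (mstep ^^ (s' - s)) t"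
    using assms(2) unfolding t_def by (metis comp_apply funpow_add le_add_diff_inverse2)
  then show ?thesis
    using fin[of "s' - s"] \<open>out u = out t\<close> unfolding run t_def[symmetric] by auto
qed

lemma eval_run:
  assumes "eval r [x, k] v"
  shows "\<exists>s. run (recf_code r) x k s = Suc v"
proof -
  obtain s where "(mstep ^^ s) (st 0 (recf_code r) (list_encode [x, k]) 0) = st 2 v 0 0"
    using eval_reaches[OF assms] unfolding reaches_def by blast
  then have "run (recf_code r) x k s = Suc v"
    by (simp add: run_def st_def Let_def del: list_encode.simps)
  then show ?thesis ..
qed

text \<open>Some halting time yields \<open>Suc v\<close> by \<open>eval_run\<close>, and the
  outputs at two halting times agree by \<open>run_halted\<close>.\<close>

lemma run_eval:
  assumes "eval r [x, k] v" "run (recf_code r) x k s \<noteq> 0"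
  shows "run (recf_code r) x k s = Suc v"
proof -
  obtain s' where "run (recf_code r) x k s' = Suc v"
    using eval_run[OF assms(1)] by blast
  note s' = this
  show ?thesis
  proof (cases "s \<le> s'")
    case True
    from run_halted[OF assms(2) this] s' show ?thesis by (rule trans[OF sym])
  next
    case False
    then have "run (recf_code r) x k s = run (recf_code r) x k s'"
      by (intro run_halted) (simp_all add: s')
    then show ?thesis using s' by (rule trans)
  qed
qed

section \<open>Strings and the stages of the construction\<close>

text \<open>The codes are bijective base-2 numerals with digits 1 and 2, lowest digit first; hence
  every number is the code of a string.\<close>

fun sdec :: "nat \<Rightarrow> bool list" where
  "sdec 0 = []"
| "sdec (Suc n) = odd n # sdec (n div 2)"

lemma sdec_str_code [simp]: "sdec (str_code \<sigma>) = \<sigma>"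
proof (induction \<sigma>)
  case (Cons b \<sigma>)
  have "str_code (b # \<sigma>) = Suc (2 * str_code \<sigma> + of_bool b)" by simp
  then show ?case using Cons by (simp only: sdec.simps) simp
qed simp

lemma str_code_sdec [simp]: "str_code (sdec n) = n"
  by (induction n rule: sdec.induct) auto

definition sbit :: "bool list \<Rightarrow> nat \<Rightarrow> bool" where
  "sbit \<sigma> n \<longleftrightarrow> n < length \<sigma> \<and> \<sigma> ! n"

definition recS :: "(nat \<Rightarrow> bool list) \<Rightarrow> bool" where
  "recS f \<longleftrightarrow> rec1 (\<lambda>x. str_code (f x))"

lemma str_code_drop: "str_code (drop l \<sigma>) = ((\<lambda>c. (c - 1) div 2) ^^ l) (str_code \<sigma>)"
proof (induction l arbitrary: \<sigma>)
  case (Suc l)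
  then show ?case
    by (cases \<sigma>) (use Suc[of "[]"] in \<open>auto simp del: funpow.simps simp: funpow_Suc_right\<close>)
qed simp

lemma str_code_snoc: "str_code (\<sigma> @ [b]) = str_code \<sigma> + (if b then 2 else 1) * 2 ^ length \<sigma>"
  by (induction \<sigma>) auto

lemma length_le_str_code: "length \<sigma> \<le> str_code \<sigma>"
  by (induction \<sigma>) auto

lemma str_code_eq_0: "str_code \<sigma> = 0 \<longleftrightarrow> \<sigma> = []"
  by (cases \<sigma>) auto

lemma sbit_str_code: "sbit \<sigma> l \<longleftrightarrow> str_code (drop l \<sigma>) \<noteq> 0 \<and> str_code (drop l \<sigma>) mod 2 = 0"
proof (cases "l < length \<sigma>")
  case True
  then show ?thesis by (simp add: sbit_def Cons_nth_drop_Suc[symmetric])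
qed (simp add: sbit_def)

lemma recS_sdec [rec_intros]: "rec1 f \<Longrightarrow> recS (\<lambda>x. sdec (f x))"
  unfolding recS_def by simp

lemma rec1_str_code [rec_intros]: "recS f \<Longrightarrow> rec1 (\<lambda>x. str_code (f x))"
  unfolding recS_def .

lemma rec1_str_code_drop:
  assumes "recS f" "rec1 n"
  shows "rec1 (\<lambda>x. str_code (drop (n x) (f x)))"
proof -
  have "rec1 (\<lambda>c. (c - 1) div 2)" by (intro rec_intros)
  then show ?thesis
    unfolding str_code_drop using assms(1) by (intro rec1_funpow assms(2)) (simp_all add: recS_def)
qed

lemma recP_sbit [rec_intros]:
  assumes "recS f" "rec1 n"
  shows "recP (\<lambda>x. sbit (f x) (n x))"
  unfolding sbit_str_code by (intro rec_intros rec1_str_code_drop assms)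

lemma rec1_length [rec_intros]:
  assumes "recS f"
  shows "rec1 (\<lambda>x. length (f x))"
proof -
  have "(LEAST l. str_code (drop l \<sigma>) = 0 \<or> str_code \<sigma> \<le> l) = length \<sigma>" for \<sigma>
    by (rule Least_equality) (use length_le_str_code[of \<sigma>] in \<open>auto simp: str_code_eq_0\<close>)
  moreover have "recP (\<lambda>y. str_code (drop (psnd y) (sdec (pfst y))) = 0)"
    by (intro rec_intros rec1_str_code_drop)
  then have "rec1 (\<lambda>x. LEAST l. str_code (drop l (sdec x)) = 0 \<or> x \<le> l)"
    by (rule rec1_Least) (intro rec_intros)
  from rec1_comp[OF this, of "\<lambda>x. str_code (f x)"]
  have "rec1 (\<lambda>x. LEAST l. str_code (drop l (f x)) = 0 \<or> str_code (f x) \<le> l)"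
    using assms by (simp add: recS_def)
  ultimately show ?thesis by simp
qed

lemma recS_snoc [rec_intros]:
  assumes "recS f"
  shows "recS (\<lambda>x. f x @ [b])"
  unfolding recS_def str_code_snoc by (cases b) (simp, intro rec_intros assms)+

lemma str_code_take:
  "str_code (take n \<sigma>) =
     rec_nat 0 (\<lambda>i c. if i < length \<sigma> then c + (if sbit \<sigma> i then 2 else 1) * 2 ^ i else c) n"
  by (induction n) (auto simp: take_Suc_conv_app_nth str_code_snoc sbit_def min_def)

lemma recS_take [rec_intros]:
  assumes "recS f" "rec1 n"
  shows "recS (\<lambda>x. take (n x) (f x))"
proof -
  have "recS (\<lambda>x. take (psnd x) (sdec (pfst x)))"
    unfolding recS_def str_code_take by (intro rec1_rec_nat rec_intros)
  then have "rec1 (\<lambda>x. str_code (take (psnd x) (sdec (pfst x))))" unfolding recS_def .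
  from rec1_comp[OF this rec1_rec2[OF rec2_pair, of "\<lambda>x. str_code (f x)" n]] show ?thesis
    using assms by (simp add: recS_def)
qed

lemma rec1_str_fun:
  assumes "rec1 (\<lambda>y. g (sdec (pfst y)) (psnd y))" "recS f" "rec1 h"
  shows "rec1 (\<lambda>x. g (f x) (h x))"
  using rec1_comp[OF assms(1) rec1_rec2[OF rec2_pair, of "\<lambda>x. str_code (f x)" h]] assms(2,3)
  by (simp add: recS_def)

lemma recP_str_fun:
  assumes "recP (\<lambda>y. P (sdec (pfst y)) (psnd y))" "recS f" "rec1 h"
  shows "recP (\<lambda>x. P (f x) (h x))"
  using rec1_str_fun[of "\<lambda>\<sigma> k. of_bool (P \<sigma> k)"] assms unfolding recP_def by blast

text \<open>
  A block is \<open>(b, a, c)\<close>, so bit \<open>3 * j + 1\<close> of \<open>\<tau>\<close> says whether program \<open>j\<close> is claimed to be a total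
  martingale. \<open>ext \<tau> a\<close> is the next block of the form \<open>(False, a, False)\<close>.
\<close>

definition active :: "nat \<Rightarrow> bool list \<Rightarrow> bool" where
  "active j \<tau> \<longleftrightarrow> sbit \<tau> (3 * j + 1)"

definition val :: "nat \<Rightarrow> bool list \<Rightarrow> nat \<Rightarrow> nat \<Rightarrow> nat" where
  "val j \<sigma> k s = run j (str_code \<sigma>) k s"

abbreviation ext :: "bool list \<Rightarrow> bool \<Rightarrow> bool list" where
  "ext \<tau> a \<equiv> ((\<tau> @ [False]) @ [a]) @ [False]"

text \<open>The number \<open>k\<close> of completed blocks serves twice: as the bound on the
  programs considered so far and as the precision requested from them.\<close>

definition computed :: "bool list \<Rightarrow> nat \<Rightarrow> bool" where
  "computed \<tau> s \<longleftrightarrow> (let k = length \<tau> div 3 in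
     \<forall>j<k. active j \<tau> \<longrightarrow> val j \<tau> k s \<noteq> 0 \<and> val j (ext \<tau> False) k s \<noteq> 0 \<and> val j (ext \<tau> True) k s \<noteq> 0)"

definition rnum :: "nat \<Rightarrow> nat" where
  "rnum v = (if pfst v mod 2 = 0 then pfst v div 2 else 0)"

definition rden :: "nat \<Rightarrow> nat" where
  "rden v = Suc (psnd v)"

text \<open>
  \<open>rnum v / rden v\<close> is the positive part of \<open>rat_code v\<close>. Values of precision \<open>(1/2) ^ k\<close> that differ
  by more than \<open>2 * (1/2) ^ k\<close> approximate different reals.
\<close>

definition exceeds :: "nat \<Rightarrow> nat \<Rightarrow> nat \<Rightarrow> bool" where
  "exceeds k v w \<longleftrightarrow> rnum w * rden v * 2 ^ k + 2 * rden v * rden w < rnum v * rden w * 2 ^ k"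

definition raised :: "bool \<Rightarrow> bool list \<Rightarrow> nat \<Rightarrow> bool" where
  "raised a \<tau> s \<longleftrightarrow> (let k = length \<tau> div 3 in
     \<exists>j<k. active j \<tau> \<and> exceeds k (val j (ext \<tau> a) k s - 1) (val j \<tau> k s - 1))"

text \<open>Verdict 0 makes the next block fair; 1 and 2 force it to be \<open>ext \<tau> False\<close> and \<open>ext \<tau> True\<close>.\<close>

definition verdict :: "bool list \<Rightarrow> nat \<Rightarrow> nat" where
  "verdict \<tau> s =
     (if \<not> computed \<tau> s then 0 else if raised False \<tau> s then 1 else if raised True \<tau> s then 2 else 0)"

definition dead :: "bool list \<Rightarrow> bool" where
  "dead \<tau> \<longleftrightarrow> (\<exists>j<length \<tau> div 3. sbit \<tau> (3 * j + 2))"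

text \<open>
  Dead strings are those that have once taken the exit \<open>c = True\<close>. A forced block receives its mass
  at once, and hence must be settled as soon as the force applies; this is what the last disjunct
  is for.
\<close>

definition settled :: "bool list \<Rightarrow> nat \<Rightarrow> bool" where
  "settled \<tau> s \<longleftrightarrow>
     dead \<tau> \<or> computed \<tau> s \<or> (\<exists>i<length \<tau> div 3. verdict (take (3 * i) \<tau>) s \<noteq> 0)"

text \<open>The cap \<open>k\<close> makes the search total although \<open>\<tau>\<close> may never
  be settled.\<close>

definition stage :: "nat \<Rightarrow> bool list \<Rightarrow> nat" where
  "stage k \<tau> = (LEAST s. settled \<tau> s \<or> k \<le> s)"

definition base :: "bool list \<Rightarrow> bool list" where
  "base \<xi> = take (3 * (length \<xi> div 3)) \<xi>"

definition verdict_at :: "nat \<Rightarrow> bool list \<Rightarrow> nat" where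
  "verdict_at k \<tau> = verdict \<tau> (stage k \<tau>)"

text \<open>
  \<open>pnum k \<xi> / 2 ^ pexp k \<xi>\<close> is the probability that \<open>False\<close> follows \<open>\<xi>\<close>, as far as it is known at stage
  \<open>k\<close>: what is not settled by then has mass 0.
\<close>

definition pnum :: "nat \<Rightarrow> bool list \<Rightarrow> nat" where
  "pnum k \<xi> = (let d = verdict_at k (base \<xi>); l = length \<xi> mod 3; \<tau> = \<xi> @ [False] in
     if l = 0 then 1
     else if l = 1 then (if d = 2 then 0 else 1)
     else if d = 0 \<and> \<not> settled \<tau> (stage k \<tau>) then 0 else 1)"

definition pexp :: "nat \<Rightarrow> bool list \<Rightarrow> nat" where
  "pexp k \<xi> = (let d = verdict_at k (base \<xi>); l = length \<xi> mod 3; \<tau> = \<xi> @ [False] in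
     if d \<noteq> 0 then 0
     else if l < 2 then 1
     else if settled \<tau> (stage k \<tau>) then stage k \<tau> else 0)"

definition mnum :: "nat \<Rightarrow> bool list \<Rightarrow> nat" where
  "mnum k \<sigma> = (\<Prod>l<length \<sigma>. if sbit \<sigma> l then 2 ^ pexp k (take l \<sigma>) - pnum k (take l \<sigma>) else pnum k (take l \<sigma>))"

definition mexp :: "nat \<Rightarrow> bool list \<Rightarrow> nat" where
  "mexp k \<sigma> = (\<Sum>l<length \<sigma>. pexp k (take l \<sigma>))"

text \<open>Guarantees that all verdicts entering \<open>capital s \<sigma>\<close> are final; see
  \<open>capital_ready\<close>.\<close>

definition ready :: "bool list \<Rightarrow> nat \<Rightarrow> bool" where
  "ready \<sigma> s \<longleftrightarrow> (\<forall>i<Suc (length \<sigma> div 3). settled (take (3 * i) \<sigma>) (stage s (take (3 * i) \<sigma>)))"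

definition capital :: "nat \<Rightarrow> bool list \<Rightarrow> nat" where
  "capital s \<sigma> = (\<Prod>l<length \<sigma>.
     if l mod 3 = 0 \<and> verdict_at s (take l \<sigma>) = 0 then (if sbit \<sigma> l then 0 else 2) else 1)"

section \<open>Computability of the finite-stage data\<close>

lemma rec1_val [rec_intros]:
  "rec1 j \<Longrightarrow> recS \<sigma> \<Longrightarrow> rec1 k \<Longrightarrow> rec1 s \<Longrightarrow> rec1 (\<lambda>x. val (j x) (\<sigma> x) (k x) (s x))"
  unfolding val_def by (intro rec_intros)

lemma recP_active [rec_intros]: "rec1 j \<Longrightarrow> recS \<sigma> \<Longrightarrow> recP (\<lambda>x. active (j x) (\<sigma> x))"
  unfolding active_def by (intro rec_intros)

lemma recP_exceeds [rec_intros]: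
  "rec1 k \<Longrightarrow> rec1 v \<Longrightarrow> rec1 w \<Longrightarrow> recP (\<lambda>x. exceeds (k x) (v x) (w x))"
  unfolding exceeds_def rnum_def rden_def by (intro rec_intros)

lemma recP_computed [rec_intros]: "recS \<tau> \<Longrightarrow> rec1 s \<Longrightarrow> recP (\<lambda>x. computed (\<tau> x) (s x))"
  by (rule recP_str_fun) (unfold computed_def Let_def, intro recP_all rec_intros)

lemma recP_raised [rec_intros]: "recS \<tau> \<Longrightarrow> rec1 s \<Longrightarrow> recP (\<lambda>x. raised a (\<tau> x) (s x))"
  by (rule recP_str_fun) (unfold raised_def Let_def, intro recP_ex rec_intros)

lemma rec1_verdict [rec_intros]: "recS \<tau> \<Longrightarrow> rec1 s \<Longrightarrow> rec1 (\<lambda>x. verdict (\<tau> x) (s x))"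
  unfolding verdict_def by (intro rec_intros)

lemma recP_settled [rec_intros]: "recS \<tau> \<Longrightarrow> rec1 s \<Longrightarrow> recP (\<lambda>x. settled (\<tau> x) (s x))"
  by (rule recP_str_fun) (unfold settled_def dead_def, intro recP_ex rec_intros)

lemma rec1_stage [rec_intros]: "rec1 k \<Longrightarrow> recS \<tau> \<Longrightarrow> rec1 (\<lambda>x. stage (k x) (\<tau> x))"
  by (rule rec1_str_fun[of "\<lambda>\<tau> k. stage k \<tau>"]) (unfold stage_def, intro rec1_Least rec_intros)

lemma recS_base [rec_intros]: "recS \<xi> \<Longrightarrow> recS (\<lambda>x. base (\<xi> x))"
  unfolding base_def by (intro rec_intros)

lemma rec1_verdict_at [rec_intros]: "rec1 k \<Longrightarrow> recS \<tau> \<Longrightarrow> rec1 (\<lambda>x. verdict_at (k x) (\<tau> x))"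
  unfolding verdict_at_def by (intro rec_intros)

lemma rec1_pnum [rec_intros]: "rec1 k \<Longrightarrow> recS \<xi> \<Longrightarrow> rec1 (\<lambda>x. pnum (k x) (\<xi> x))"
  unfolding pnum_def Let_def by (intro rec_intros)

lemma rec1_pexp [rec_intros]: "rec1 k \<Longrightarrow> recS \<xi> \<Longrightarrow> rec1 (\<lambda>x. pexp (k x) (\<xi> x))"
  unfolding pexp_def Let_def by (intro rec_intros)

lemma rec1_mnum [rec_intros]: "rec1 k \<Longrightarrow> recS \<sigma> \<Longrightarrow> rec1 (\<lambda>x. mnum (k x) (\<sigma> x))"
  by (rule rec1_str_fun[of "\<lambda>\<tau> k. mnum k \<tau>"]) (unfold mnum_def, intro rec1_prod rec_intros)

lemma rec1_mexp [rec_intros]: "rec1 k \<Longrightarrow> recS \<sigma> \<Longrightarrow> rec1 (\<lambda>x. mexp (k x) (\<sigma> x))"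
  by (rule rec1_str_fun[of "\<lambda>\<tau> k. mexp k \<tau>"]) (unfold mexp_def, intro rec1_sum rec_intros)

lemma recP_ready [rec_intros]: "recS \<sigma> \<Longrightarrow> rec1 s \<Longrightarrow> recP (\<lambda>x. ready (\<sigma> x) (s x))"
  by (rule recP_str_fun) (unfold ready_def, intro recP_all rec_intros)

lemma rec1_capital [rec_intros]: "rec1 s \<Longrightarrow> recS \<sigma> \<Longrightarrow> rec1 (\<lambda>x. capital (s x) (\<sigma> x))"
  by (rule rec1_str_fun[of "\<lambda>\<tau> k. capital k \<tau>"]) (unfold capital_def, intro rec1_prod rec_intros)

section \<open>Measures with given conditional probabilities\<close>

text \<open>\<open>cprod p \<sigma>\<close> is the mass of \<open>[\<sigma>]\<close> when \<open>p \<xi>\<close> is the probability that \<open>False\<close> follows \<open>\<xi>\<close>.\<close>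

definition cprod :: "(bool list \<Rightarrow> real) \<Rightarrow> bool list \<Rightarrow> real" where
  "cprod p \<sigma> = (\<Prod>l<length \<sigma>. if \<sigma> ! l then 1 - p (take l \<sigma>) else p (take l \<sigma>))"

lemma cprod_Nil [simp]: "cprod p [] = 1"
  by (simp add: cprod_def)

lemma cprod_snoc [simp]: "cprod p (\<sigma> @ [b]) = cprod p \<sigma> * (if b then 1 - p \<sigma> else p \<sigma>)"
proof -
  let ?f = "\<lambda>\<tau> l. if \<tau> ! l then 1 - p (take l \<tau>) else p (take l \<tau>)"
  have "(\<Prod>l<length \<sigma>. ?f (\<sigma> @ [b]) l) = (\<Prod>l<length \<sigma>. ?f \<sigma> l)"
    by (intro prod.cong) (auto simp: nth_append)
  then show ?thesis by (simp add: cprod_def)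
qed

lemma cprod_nonneg:
  assumes "\<And>\<xi>. 0 \<le> p \<xi>" "\<And>\<xi>. p \<xi> \<le> 1"
  shows "0 \<le> cprod p \<sigma>"
  unfolding cprod_def by (intro prod_nonneg) (simp add: assms)

text \<open>
  The intervals \<open>[lower p \<sigma>, lower p \<sigma> + cprod p \<sigma>)\<close> with \<open>length \<sigma> = n\<close> partition the unit interval, so
  reading off the interval of a uniform random number yields the required distribution.
\<close>

definition lower :: "(bool list \<Rightarrow> real) \<Rightarrow> bool list \<Rightarrow> real" where
  "lower p \<sigma> = (\<Sum>l<length \<sigma>. if \<sigma> ! l then cprod p (take l \<sigma> @ [False]) else 0)"

lemma lower_snoc: "lower p (\<sigma> @ [b]) = lower p \<sigma> + (if b then cprod p (\<sigma> @ [False]) else 0)"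
proof -
  let ?f = "\<lambda>\<tau> l. if \<tau> ! l then cprod p (take l \<tau> @ [False]) else 0"
  have "(\<Sum>l<length \<sigma>. ?f (\<sigma> @ [b]) l) = (\<Sum>l<length \<sigma>. ?f \<sigma> l)"
    by (intro sum.cong) (auto simp: nth_append)
  then show ?thesis by (simp add: lower_def)
qed

primrec quantile :: "(bool list \<Rightarrow> real) \<Rightarrow> nat \<Rightarrow> real \<Rightarrow> bool list" where
  "quantile p 0 u = []"
| "quantile p (Suc n) u =
     quantile p n u @ [lower p (quantile p n u) + cprod p (quantile p n u @ [False]) \<le> u]"

lemma length_quantile [simp]: "length (quantile p n u) = n"
  by (induction n) auto

lemma quantile_iff:
  assumes p: "\<And>\<xi>. 0 \<le> p \<xi>" "\<And>\<xi>. p \<xi> \<le> 1" and u: "0 \<le> u" "u < 1"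
  shows "quantile p (length \<sigma>) u = \<sigma> \<longleftrightarrow> lower p \<sigma> \<le> u \<and> u < lower p \<sigma> + cprod p \<sigma>"
proof (induction \<sigma> rule: rev_induct)
  case (snoc b \<sigma>)
  have "cprod p (\<sigma> @ [b]) \<ge> 0" for b by (intro cprod_nonneg p)
  from this[of True] this[of False]
  show ?case using snoc by (auto simp: lower_snoc algebra_simps)
qed (simp add: lower_def u)

lemma measurable_quantile [measurable]: "quantile p n \<in> borel \<rightarrow>\<^sub>M count_space UNIV"
proof -
  have "{u. quantile p n u = \<sigma>} \<in> sets borel" for \<sigma>
  proof (induction n arbitrary: \<sigma>)
    case (Suc n)
    have "{u. quantile p (Suc n) u = \<sigma>} =
      (if \<sigma> = [] then {} else {u. quantile p n u = butlast \<sigma>} \<inter>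
        {u. (lower p (butlast \<sigma>) + cprod p (butlast \<sigma> @ [False]) \<le> u) = last \<sigma>})"
      by (cases \<sigma> rule: rev_cases) auto
    also have "\<dots> \<in> sets borel" using Suc[of "butlast \<sigma>"] by auto
    finally show ?case .
  qed simp
  then show ?thesis
    by (subst measurable_count_space_eq2_countable) (auto simp: vimage_def)
qed

lemma cyl_measurable: "cyl \<sigma> \<in> sets cantor"
proof -
  have "cyl \<sigma> = {X \<in> space cantor. \<forall>i<length \<sigma>. X i = \<sigma> ! i}"
    by (auto simp: cyl_def cantor_def space_PiM)
  also have "\<dots> \<in> sets cantor" unfolding cantor_def by measurable
  finally show ?thesis .
qed

theorem measure_of_conditional_probabilities:
  assumes p: "\<And>\<xi>. 0 \<le> p \<xi>" "\<And>\<xi>. p \<xi> \<le> 1"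
  shows "\<exists>\<mu>. prob_measure_cantor \<mu> \<and> (\<forall>\<sigma>. mu \<mu> \<sigma> = cprod p \<sigma>)"
proof -
  define U where "U = uniform_measure lborel {0..<1::real}"
  define X where "X u n = last (quantile p (Suc n) u)" for u n
  interpret U: prob_space U
    unfolding U_def by (rule prob_space_uniform_measure) auto
  have X_meas: "X \<in> U \<rightarrow>\<^sub>M cantor"
  proof -
    have "(\<lambda>u. last (quantile p (Suc n) u)) \<in> U \<rightarrow>\<^sub>M count_space UNIV" for n
    proof -
      have "quantile p (Suc n) \<in> U \<rightarrow>\<^sub>M count_space UNIV"
        using measurable_quantile[of p "Suc n"] by (simp add: U_def measurable_def)
      then show ?thesis by (rule measurable_compose[where g = last]) simp
    qed
    then show ?thesis
      unfolding cantor_def X_def[abs_def]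
      by (intro measurable_PiM_single'[where f = "\<lambda>n u. last (quantile p (Suc n) u)"])
        (auto simp: space_PiM PiE_def)
  qed
  define \<mu> where "\<mu> = distr U cantor X"
  \<comment> \<open>The strings \<open>quantile p n u\<close> extend one another, so they are the
    prefixes of one sequence and a cylinder pulls back to a single quantile event.\<close>
  have map_X: "map (X u) [0..<n] = quantile p n u" for u n
  proof (induction n)
    case (Suc n)
    then show ?case by (simp add: X_def)
  qed simp
  have X_cyl: "X u \<in> cyl \<sigma> \<longleftrightarrow> quantile p (length \<sigma>) u = \<sigma>" for u \<sigma>
    unfolding map_X[symmetric] cyl_def list_eq_iff_nth_eq by simp
  have cyl: "mu \<mu> \<sigma> = cprod p \<sigma>" for \<sigma>
  proof -
    have nonneg: "0 \<le> cprod p \<sigma>" for \<sigma> by (intro cprod_nonneg p)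
    \<comment> \<open>Needed because \<open>quantile_iff\<close> speaks of \<open>u\<close> in the
      unit interval only: the interval of \<open>\<sigma>\<close> must not stick out of it.\<close>
    have "0 \<le> lower p \<sigma> \<and> lower p \<sigma> + cprod p \<sigma> \<le> 1"
    proof (induction \<sigma> rule: rev_induct)
      case (snoc b \<sigma>)
      then show ?case
        using nonneg[of "\<sigma> @ [True]"] nonneg[of "\<sigma> @ [False]"]
        by (auto simp: lower_snoc algebra_simps)
    qed (simp add: lower_def)
    then have eq: "{0..<1} \<inter> X -` cyl \<sigma> = {lower p \<sigma>..<lower p \<sigma> + cprod p \<sigma>}"
      using quantile_iff[OF p] by (auto simp: X_cyl)
    have "mu \<mu> \<sigma> = measure U (X -` cyl \<sigma>)"
      unfolding mu_def \<mu>_def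
      by (subst measure_distr[OF X_meas cyl_measurable]) (simp add: U_def)
    also have "\<dots> = measure lborel ({0..<1} \<inter> X -` cyl \<sigma>)"
      using measurable_sets[OF X_meas cyl_measurable[of \<sigma>]]
      unfolding U_def by (subst measure_uniform_measure) auto
    also have "\<dots> = cprod p \<sigma>" unfolding eq using nonneg by simp
    finally show ?thesis .
  qed
  have "prob_measure_cantor \<mu>"
    unfolding prob_measure_cantor_def \<mu>_def using U.prob_space_distr[OF X_meas] by simp
  with cyl show ?thesis by blast
qed

section \<open>The measure and the partial martingale\<close>

definition halting :: "bool list \<Rightarrow> bool" where
  "halting \<tau> \<longleftrightarrow> (\<exists>s. settled \<tau> s)"

text \<open>Without \<open>halting \<tau>\<close> the values \<open>htime \<tau>\<close> and \<open>final \<tau>\<close> are junk, but then \<open>[\<tau>]\<close> has mass 0.\<close>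

definition htime :: "bool list \<Rightarrow> nat" where
  "htime \<tau> = (LEAST s. settled \<tau> s)"

definition final :: "bool list \<Rightarrow> nat" where
  "final \<tau> = verdict \<tau> (htime \<tau>)"

definition settled_by :: "nat \<Rightarrow> bool list \<Rightarrow> bool" where
  "settled_by k \<tau> \<longleftrightarrow> (\<exists>s\<le>k. settled \<tau> s)"

definition weight :: "bool list \<Rightarrow> real" where
  "weight \<tau> = (if halting \<tau> then (1/2) ^ htime \<tau> else 0)"

definition weight_at :: "nat \<Rightarrow> bool list \<Rightarrow> real" where
  "weight_at k \<tau> = (if settled \<tau> (stage k \<tau>) then (1/2) ^ stage k \<tau> else 0)"

text \<open>The residue of \<open>l\<close> selects the bit b, a or c of the block. A non-zero
  verdict \<open>d\<close> sends all mass to b = False, to the value of a that it names, and to c =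
  False.\<close>

definition cond :: "nat \<Rightarrow> nat \<Rightarrow> real \<Rightarrow> real" where
  "cond l d w =
     (if l mod 3 = 0 then if d = 0 then 1/2 else 1
      else if l mod 3 = 1 then if d = 0 then 1/2 else if d = 2 then 0 else 1
      else if d = 0 then w else 1)"

definition prob0 :: "bool list \<Rightarrow> real" where
  "prob0 \<xi> = cond (length \<xi>) (final (base \<xi>)) (weight (\<xi> @ [False]))"

definition prob0_at :: "nat \<Rightarrow> bool list \<Rightarrow> real" where
  "prob0_at k \<xi> = cond (length \<xi>) (verdict_at k (base \<xi>)) (weight_at k (\<xi> @ [False]))"

lemma settled_htime: "settled \<tau> s \<Longrightarrow> settled \<tau> (htime \<tau>) \<and> htime \<tau> \<le> s"
  unfolding htime_def by (blast intro: LeastI Least_le)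

lemma stage_settled_by:
  assumes "settled_by k \<tau>"
  shows "stage k \<tau> = htime \<tau>" "settled \<tau> (stage k \<tau>)"
proof -
  obtain s where "s \<le> k" "settled \<tau> s" using assms unfolding settled_by_def by blast
  with settled_htime[of \<tau> s] have *: "settled \<tau> (htime \<tau>)" "htime \<tau> \<le> k" by auto
  have "s \<ge> htime \<tau>" if "settled \<tau> s \<or> k \<le> s" for s
    using that settled_htime[of \<tau> s] *(2) by auto
  then show "stage k \<tau> = htime \<tau>"
    unfolding stage_def using *(1) by (intro Least_equality) auto
  with * show "settled \<tau> (stage k \<tau>)" by simp
qed

lemma settled_stage_iff: "settled \<tau> (stage k \<tau>) \<longleftrightarrow> settled_by k \<tau>"
proof
  assume "settled \<tau> (stage k \<tau>)"
  moreover have "stage k \<tau> \<le> k" unfolding stage_def by (rule Least_le) simp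
  ultimately show "settled_by k \<tau>" unfolding settled_by_def by blast
qed (rule stage_settled_by)

lemma verdict_at_settled_by: "settled_by k \<tau> \<Longrightarrow> verdict_at k \<tau> = final \<tau>"
  by (simp add: verdict_at_def final_def stage_settled_by)

lemma weight_bounds: "0 \<le> weight \<tau>" "weight \<tau> \<le> 1"
  by (auto simp: weight_def power_le_one)

lemma weight_at_bounds: "0 \<le> weight_at k \<tau>" "weight_at k \<tau> \<le> 1"
  by (auto simp: weight_at_def power_le_one)

lemma weight_at_settled_by: "settled_by k \<tau> \<Longrightarrow> weight_at k \<tau> = weight \<tau>"
  using stage_settled_by[of k \<tau>] by (auto simp: weight_at_def weight_def halting_def)

text \<open>Either \<open>\<tau>\<close> settles later and its weight is a higher power of 1/2, or
  it never settles and the weight is 0. The bound holds without knowing which, and this makes the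
  measure computable.\<close>

lemma weight_at_not_settled_by:
  assumes "\<not> settled_by k \<tau>"
  shows "weight_at k \<tau> = 0" "weight \<tau> \<le> (1/2) ^ k"
proof -
  show "weight_at k \<tau> = 0" using assms by (simp add: weight_at_def settled_stage_iff)
  show "weight \<tau> \<le> (1/2) ^ k"
  proof (cases "halting \<tau>")
    case True
    then obtain s where "settled \<tau> s" unfolding halting_def by blast
    then have "k \<le> htime \<tau>"
      using settled_htime assms unfolding settled_by_def by (meson nat_le_linear)
    then show ?thesis using True by (simp add: weight_def power_decreasing)
  qed (simp add: weight_def)
qed

lemma prob0_bounds: "0 \<le> prob0 \<xi>" "prob0 \<xi> \<le> 1"
  and prob0_at_bounds: "0 \<le> prob0_at k \<xi>" "prob0_at k \<xi> \<le> 1"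
  using weight_bounds weight_at_bounds by (simp_all add: prob0_def prob0_at_def cond_def)

section \<open>Block boundaries, exits and forced blocks\<close>

lemma base_snoc: "base (\<xi> @ [b]) = (if length \<xi> mod 3 = 2 then \<xi> @ [b] else base \<xi>)"
proof (cases "length \<xi> mod 3 = 2")
  case True
  then have "3 * (Suc (length \<xi>) div 3) = Suc (length \<xi>)" by presburger
  then show ?thesis using True by (simp add: base_def del: div_Suc)
next
  case False
  then have "Suc (length \<xi>) div 3 = length \<xi> div 3" "3 * (length \<xi> div 3) \<le> length \<xi>"
    by presburger+
  then show ?thesis using False by (simp add: base_def del: div_Suc)
qed

lemma base_id: "length \<xi> mod 3 = 0 \<Longrightarrow> base \<xi> = \<xi>"
  by (auto simp: base_def)

lemma base_append: "\<exists>u. \<xi> = base \<xi> @ u"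
  unfolding base_def by (metis append_take_drop_id)

lemma dead_append: "dead \<tau> \<Longrightarrow> dead (\<tau> @ u)"
proof -
  assume "dead \<tau>"
  then obtain j where "j < length \<tau> div 3" "sbit \<tau> (3 * j + 2)" unfolding dead_def by blast
  moreover have "length \<tau> div 3 \<le> length (\<tau> @ u) div 3" by (intro div_le_mono) simp
  ultimately show ?thesis unfolding dead_def by (auto simp: sbit_def nth_append intro!: exI[of _ j])
qed

lemma dead_snoc_True:
  assumes "length \<xi> mod 3 = 2"
  shows "dead (\<xi> @ [True])"
proof -
  have "length \<xi> div 3 < Suc (length \<xi>) div 3" "3 * (length \<xi> div 3) + 2 = length \<xi>"
    using assms by presburger+
  then show ?thesis
    unfolding dead_def by (intro exI[of _ "length \<xi> div 3"]) (simp add: sbit_def del: div_Suc)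
qed

lemma dead_settled_by: "dead \<tau> \<Longrightarrow> settled_by k \<tau>"
  unfolding settled_by_def settled_def by blast

lemma settled_Nil: "settled [] s"
  by (simp add: settled_def computed_def)

lemma settled_of_verdict:
  assumes "length \<xi> mod 3 = 2" "verdict (base \<xi>) s \<noteq> 0"
  shows "settled (\<xi> @ [b]) s"
proof -
  have "length \<xi> div 3 < length (\<xi> @ [b]) div 3" using assms(1) by simp presburger
  moreover have "take (3 * (length \<xi> div 3)) (\<xi> @ [b]) = base \<xi>" by (simp add: base_def)
  ultimately show ?thesis using assms(2) unfolding settled_def by metis
qed

lemma settled_of_final:
  assumes "length \<xi> mod 3 = 2" "settled_by k (base \<xi>)" "final (base \<xi>) \<noteq> 0"
  shows "settled_by k (\<xi> @ [b])"
proof -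
  have "htime (base \<xi>) \<le> k"
    using assms(2) settled_htime unfolding settled_by_def by (meson le_trans)
  moreover have "settled (\<xi> @ [b]) (htime (base \<xi>))"
    using assms(3) by (intro settled_of_verdict assms(1)) (simp add: final_def)
  ultimately show ?thesis unfolding settled_by_def by blast
qed

text \<open>Errors do not accumulate. The two conditional probabilities first differ where the
  boundary after c = False is unsettled at stage \<open>k\<close>. On that side the approximate mass
  becomes 0 for good and the true mass is at most \<open>(1/2) ^ k\<close>. On the exit side an
  error of at most \<open>(1/2) ^ k\<close> appears, but all later conditional probabilities agree,
  as dead strings are settled at stage 0; the error is then only multiplied by numbers in
  [0, 1].\<close>

lemma approximation_error:
  "\<bar>cprod (prob0_at k) \<sigma> - cprod prob0 \<sigma>\<bar> \<le> (1/2) ^ k"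
proof -
  let ?m = "cprod prob0" and ?n = "cprod (prob0_at k)" and ?e = "(1/2::real) ^ k"
  have m: "0 \<le> ?m \<sigma>" and n: "0 \<le> ?n \<sigma>" for \<sigma>
    by (intro cprod_nonneg prob0_bounds prob0_at_bounds)+
  have m1: "?m \<sigma> \<le> 1" for \<sigma>
    unfolding cprod_def by (intro prod_le_1) (simp add: prob0_bounds)
  have "(?n \<sigma> = ?m \<sigma> \<and> settled_by k (base \<sigma>)) \<or> (?n \<sigma> = 0 \<and> ?m \<sigma> \<le> ?e) \<or>
      (dead (base \<sigma>) \<and> \<bar>?n \<sigma> - ?m \<sigma>\<bar> \<le> ?e)"
  proof (induction \<sigma> rule: rev_induct)
    case Nil
    show ?case using settled_Nil by (simp add: base_def settled_by_def) blast
  next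
    case (snoc b \<sigma>)
    have deadT: "dead (base (\<sigma> @ [b]))" if "length \<sigma> mod 3 = 2" "b"
      using that dead_snoc_True by (simp add: base_snoc)
    from snoc show ?case
    proof (elim disjE conjE)
      assume eq: "?n \<sigma> = ?m \<sigma>" and w: "settled_by k (base \<sigma>)"
      note fin = verdict_at_settled_by[OF w]
      show ?thesis
      proof (cases "length \<sigma> mod 3 = 2 \<and> final (base \<sigma>) = 0 \<and> \<not> settled_by k (\<sigma> @ [False])")
        case True
        note W = weight_at_not_settled_by[of k "\<sigma> @ [False]"]
        have p: "prob0 \<sigma> = weight (\<sigma> @ [False])" "prob0_at k \<sigma> = 0"
          using True fin W by (simp_all add: prob0_def prob0_at_def cond_def)
        have le: "?m \<sigma> * prob0 \<sigma> \<le> ?e"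
        proof -
          have "?m \<sigma> * prob0 \<sigma> \<le> 1 * prob0 \<sigma>"
            by (intro mult_right_mono m1 prob0_bounds)
          with p W True show ?thesis by simp
        qed
        show ?thesis
        proof (cases b)
          case b: True
          have "\<bar>?n (\<sigma> @ [b]) - ?m (\<sigma> @ [b])\<bar> = ?m \<sigma> * prob0 \<sigma>"
            using b eq p m[of \<sigma>] prob0_bounds(1)[of \<sigma>] by (simp add: algebra_simps)
          then show ?thesis using deadT True b le by simp
        qed (use p le in simp)
      next
        case False
        then have "prob0_at k \<sigma> = prob0 \<sigma>"
          using fin weight_at_settled_by[of k "\<sigma> @ [False]"] mod_less_divisor[of 3 "length \<sigma>"]
          by (auto simp: prob0_def prob0_at_def cond_def)
        moreover have "settled_by k (base (\<sigma> @ [b]))"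
          using False w deadT settled_of_final[of \<sigma> k b] dead_settled_by by (cases b) (auto simp: base_snoc)
        ultimately show ?thesis using eq by simp
      qed
    next
      assume z: "?n \<sigma> = 0" and le: "?m \<sigma> \<le> ?e"
      have "?m (\<sigma> @ [b]) \<le> ?m \<sigma> * 1"
        unfolding cprod_snoc by (intro mult_left_mono m) (use prob0_bounds[of \<sigma>] in auto)
      with z le show ?thesis by simp
    next
      assume d: "dead (base \<sigma>)" and le: "\<bar>?n \<sigma> - ?m \<sigma>\<bar> \<le> ?e"
      have "dead (\<sigma> @ [c])" for c
        using d base_append[of \<sigma>] dead_append by (metis append.assoc)
      then have d': "dead (base (\<sigma> @ [b]))" and eq: "prob0_at k \<sigma> = prob0 \<sigma>"
        using d by (auto simp: base_snoc prob0_def prob0_at_def verdict_at_settled_by weight_at_settled_by dead_settled_by)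
      define q where "q = (if b then 1 - prob0 \<sigma> else prob0 \<sigma>)"
      have q: "0 \<le> q" "q \<le> 1" using prob0_bounds[of \<sigma>] by (auto simp: q_def)
      have "?n (\<sigma> @ [b]) - ?m (\<sigma> @ [b]) = (?n \<sigma> - ?m \<sigma>) * q"
        by (simp add: eq q_def left_diff_distrib)
      then have "\<bar>?n (\<sigma> @ [b]) - ?m (\<sigma> @ [b])\<bar> = \<bar>?n \<sigma> - ?m \<sigma>\<bar> * q"
        using q by (simp add: abs_mult)
      also have "\<dots> \<le> \<bar>?n \<sigma> - ?m \<sigma>\<bar>" using q by (simp add: mult_left_le)
      finally show ?thesis using d' le by simp
    qed
  qed
  then show ?thesis using m[of \<sigma>] by auto
qed

section \<open>Dyadic form of the approximations and computability of the measure\<close>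

lemma pnum_le: "pnum k \<xi> \<le> 2 ^ pexp k \<xi>"
  by (auto simp: pnum_def Let_def)

lemma prob0_at_eq: "prob0_at k \<xi> = pnum k \<xi> / 2 ^ pexp k \<xi>"
  by (auto simp: prob0_at_def cond_def pnum_def pexp_def weight_at_def Let_def power_one_over)

lemma cprod_prob0_at: "cprod (prob0_at k) \<sigma> = mnum k \<sigma> / 2 ^ mexp k \<sigma>"
proof -
  have "cprod (prob0_at k) \<sigma> = (\<Prod>l<length \<sigma>.
      (if sbit \<sigma> l then 2 ^ pexp k (take l \<sigma>) - pnum k (take l \<sigma>) else pnum k (take l \<sigma>)) /
      2 ^ pexp k (take l \<sigma>))"
    unfolding cprod_def
    by (intro prod.cong) (auto simp: prob0_at_eq sbit_def diff_divide_distrib of_nat_diff pnum_le)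
  also have "\<dots> = mnum k \<sigma> / 2 ^ mexp k \<sigma>"
    by (simp add: mnum_def mexp_def prod_dividef power_sum)
  finally show ?thesis .
qed

lemma rat_code_fraction: "rat_code (pair (2 * a) b) = a / Suc b"
  by (simp add: rat_code_def int_decode_def sum_decode_def)

lemma rec2I: "rec1 (\<lambda>y. g (pfst y) (psnd y)) \<Longrightarrow> rec2 g"
  using rec2_comp1[OF _ rec2_pair, of "\<lambda>y. g (pfst y) (psnd y)"] by simp

lemma computable_measure_prob0:
  assumes "\<And>\<sigma>. mu \<mu> \<sigma> = cprod prob0 \<sigma>"
  shows "computable_measure \<mu>"
proof -
  have "rec2 (\<lambda>x k. pair (2 * mnum k (sdec x)) (2 ^ mexp k (sdec x) - 1))"
    by (intro rec2I rec_intros)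
  then obtain r where r: "\<And>x k. eval r [x, k] (pair (2 * mnum k (sdec x)) (2 ^ mexp k (sdec x) - 1))"
    unfolding rec2_def by blast
  show ?thesis unfolding computable_measure_def
  proof (intro exI allI conjI)
    fix \<sigma> k
    show "eval r [str_code \<sigma>, k] (pair (2 * mnum k \<sigma>) (2 ^ mexp k \<sigma> - 1))"
      using r[of "str_code \<sigma>" k] by simp
    have "rat_code (pair (2 * mnum k \<sigma>) (2 ^ mexp k \<sigma> - 1)) = cprod (prob0_at k) \<sigma>"
      by (simp add: rat_code_fraction cprod_prob0_at of_nat_diff)
    then show "\<bar>rat_code (pair (2 * mnum k \<sigma>) (2 ^ mexp k \<sigma> - 1)) - mu \<mu> \<sigma>\<bar> \<le> (1/2) ^ k"
      using approximation_error assms by simp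
  qed
qed

text \<open>Mass reaches a block boundary in three ways: through the exit, which is settled at once;
  through a forced block, where the verdict itself settles it; or through a fair block, where
  positive weight means halting.\<close>

lemma halting_base:
  assumes "0 < cprod prob0 \<sigma>"
  shows "halting (base \<sigma>)"
  using assms
proof (induction \<sigma> rule: rev_induct)
  case Nil
  show ?case using settled_Nil by (auto simp: halting_def base_def)
next
  case (snoc b \<sigma>)
  have "0 \<le> cprod prob0 \<sigma>" by (intro cprod_nonneg prob0_bounds)
  with snoc.prems have pos: "0 < cprod prob0 \<sigma>" "0 < (if b then 1 - prob0 \<sigma> else prob0 \<sigma>)"
    by (auto simp: zero_less_mult_iff)
  show ?case
  proof (cases "length \<sigma> mod 3 = 2")
    case True
    show ?thesis
    proof (cases b)
      case b: True
      then show ?thesis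
        using dead_settled_by[OF dead_snoc_True[OF True]] True by (auto simp: base_snoc halting_def settled_by_def)
    next
      case False
      with pos have p: "0 < prob0 \<sigma>" by simp
      show ?thesis
      proof (cases "final (base \<sigma>) = 0")
        case fin: True
        then have "0 < weight (\<sigma> @ [False])" using p True by (simp add: prob0_def cond_def)
        then show ?thesis using False True by (auto simp: weight_def base_snoc split: if_splits)
      next
        case fin: False
        then show ?thesis
          using settled_of_verdict[OF True] True unfolding halting_def final_def by (auto simp: base_snoc)
      qed
    qed
  qed (use snoc.IH pos in \<open>simp add: base_snoc\<close>)
qed

lemma cprod_take_pos:
  assumes "0 < cprod prob0 \<sigma>"
  shows "0 < cprod prob0 (take n \<sigma>)"
  using assms
proof (induction \<sigma> rule: rev_induct)
  case (snoc b \<sigma>)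
  have "0 \<le> cprod prob0 \<sigma>" by (intro cprod_nonneg prob0_bounds)
  with snoc.prems have "0 < cprod prob0 \<sigma>" by (auto simp: zero_less_mult_iff)
  with snoc show ?case by (cases "n \<le> length \<sigma>") auto
qed simp

section \<open>The partial martingale\<close>

definition resolved :: "bool list \<Rightarrow> bool" where
  "resolved \<sigma> \<longleftrightarrow> (\<forall>i\<le>length \<sigma> div 3. halting (take (3 * i) \<sigma>))"

lemma resolved_of_pos:
  assumes "0 < cprod prob0 \<sigma>"
  shows "resolved \<sigma>"
  unfolding resolved_def
proof (intro allI impI)
  fix i assume "i \<le> length \<sigma> div 3"
  then have "3 * i \<le> length \<sigma>" by presburger
  then show "halting (take (3 * i) \<sigma>)"
    using halting_base[OF cprod_take_pos[OF assms, of "3 * i"]] by (simp add: base_id)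
qed

definition wealth :: "bool list \<Rightarrow> real" where
  "wealth \<sigma> = (\<Prod>l<length \<sigma>. if l mod 3 = 0 \<and> final (take l \<sigma>) = 0 then if \<sigma> ! l then 0 else 2 else 1)"

definition gambler :: "bool list \<Rightarrow> real option" where
  "gambler \<sigma> = (if resolved \<sigma> then Some (wealth \<sigma>) else None)"

lemma wealth_snoc:
  "wealth (\<sigma> @ [b]) =
     wealth \<sigma> * (if length \<sigma> mod 3 = 0 \<and> final \<sigma> = 0 then if b then 0 else 2 else 1)"
proof -
  let ?f = "\<lambda>\<tau> l. if l mod 3 = 0 \<and> final (take l \<tau>) = 0 then if \<tau> ! l then 0 else 2 else (1::real)"
  have "(\<Prod>l<length \<sigma>. ?f (\<sigma> @ [b]) l) = (\<Prod>l<length \<sigma>. ?f \<sigma> l)"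
    by (intro prod.cong) (auto simp: nth_append)
  then show ?thesis by (simp add: wealth_def)
qed

text \<open>Capital is doubled or lost only on a bit b whose verdict is 0, and such a bit is fair.
  If b is forced, the capital stays the same and the side b = True is null.\<close>

lemma martingale_gambler:
  assumes mu: "\<And>\<sigma>. mu \<mu> \<sigma> = cprod prob0 \<sigma>"
  shows "martingale \<mu> gambler"
proof -
  have nonneg: "0 \<le> cprod prob0 \<sigma>" for \<sigma> by (intro cprod_nonneg prob0_bounds)
  \<comment> \<open>Null strings contribute 0 on both sides, and elsewhere \<open>gambler\<close> is
    defined; so fairness may be checked for the total function \<open>wealth\<close> on all
    strings.\<close>
  have t: "(if mu \<mu> \<tau> = 0 then 0 else the (gambler \<tau>) * mu \<mu> \<tau>) = wealth \<tau> * cprod prob0 \<tau>" for \<tau>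
    using resolved_of_pos[of \<tau>] nonneg[of \<tau>] by (auto simp: mu gambler_def)
  have "wealth (\<sigma> @ [False]) * cprod prob0 (\<sigma> @ [False]) + wealth (\<sigma> @ [True]) * cprod prob0 (\<sigma> @ [True])
      = wealth \<sigma> * cprod prob0 \<sigma>" for \<sigma>
    by (auto simp: wealth_snoc prob0_def cond_def base_id algebra_simps)
  moreover have "0 \<le> wealth \<sigma>" for \<sigma>
    unfolding wealth_def by (intro prod_nonneg) simp
  ultimately show ?thesis
    unfolding martingale_def Let_def t
    using resolved_of_pos by (auto simp: gambler_def mu split: if_splits)
qed

lemma ready_iff: "ready \<sigma> s \<longleftrightarrow> (\<forall>i\<le>length \<sigma> div 3. settled_by s (take (3 * i) \<sigma>))"
  by (auto simp: ready_def settled_stage_iff less_Suc_eq_le)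

lemma ready_resolved: "ready \<sigma> s \<Longrightarrow> resolved \<sigma>"
  unfolding ready_iff resolved_def halting_def settled_by_def by blast

lemma resolved_ready:
  assumes "resolved \<sigma>"
  shows "\<exists>s. ready \<sigma> s"
proof -
  have "\<forall>i\<in>{..length \<sigma> div 3}. \<exists>s. settled (take (3 * i) \<sigma>) s"
    using assms unfolding resolved_def halting_def by blast
  then obtain f where f: "\<And>i. i \<le> length \<sigma> div 3 \<Longrightarrow> settled (take (3 * i) \<sigma>) (f i)"
    by (metis atMost_iff)
  have "ready \<sigma> (\<Sum>i\<le>length \<sigma> div 3. f i)"
    unfolding ready_iff settled_by_def using f member_le_sum[of _ "{..length \<sigma> div 3}" f] by blast
  then show ?thesis ..
qed

lemma capital_ready:
  assumes "ready \<sigma> s"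
  shows "capital s \<sigma> = wealth \<sigma>"
proof -
  have "verdict_at s (take l \<sigma>) = final (take l \<sigma>)" if "l < length \<sigma>" "l mod 3 = 0" for l
  proof -
    have "l div 3 \<le> length \<sigma> div 3" "3 * (l div 3) = l" using that by (auto intro: div_le_mono)
    then show ?thesis using assms unfolding ready_iff by (metis verdict_at_settled_by)
  qed
  then show ?thesis
    unfolding capital_def wealth_def of_nat_prod by (intro prod.cong) (auto simp: sbit_def)
qed

lemma computable_gambler: "computable_mart gambler"
proof -
  have "rec2 (\<lambda>x s. pair (2 * capital s (sdec x)) 0)"
    by (intro rec2I rec_intros)
  then obtain g where g: "\<And>x s. eval g [x, s] (pair (2 * capital s (sdec x)) 0)"
    unfolding rec2_def by blast
  have "recP (\<lambda>y. \<not> ready (sdec (pfst y)) (psnd y))"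
    by (intro rec_intros)
  then have "rec2 (\<lambda>x s. of_bool (\<not> ready (sdec x) s))"
    unfolding recP_def by (rule rec2I)
  then obtain h where h: "\<And>x s. eval h [x, s] (of_bool (\<not> ready (sdec x) s))"
    unfolding rec2_def by blast
  \<comment> \<open>\<open>Mu\<close> puts the search variable in front, while \<open>h\<close>
    expects the string first. The precision is dropped: capital is a natural number and is output
    exactly.\<close>
  define f where "f = Comp h [Proj 1, Proj 0]"
  have f: "eval f [s, x, k] (of_bool (\<not> ready (sdec x) s))" for s x k
    unfolding f_def by (rule eval_Comp2[OF _ _ h]) (simp_all add: eval_Proj_nth)
  define r where "r = Comp g [Proj 0, Mu f]"
  have r: "eval r [x, k] (pair (2 * capital s (sdec x)) 0)"
    if "ready (sdec x) s" "\<And>s'. s' < s \<Longrightarrow> \<not> ready (sdec x) s'" for x k s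
    unfolding r_def
  proof (rule eval_Comp2[OF _ _ g])
    show "eval (Proj 0) [x, k] x" by (simp add: eval_Proj_nth)
    show "eval (Mu f) [x, k] s"
    proof (rule eval_Mu)
      show "eval f [s, x, k] 0" using f[of s x k] that(1) by simp
      show "\<forall>m<s. \<exists>y. eval f [m, x, k] (Suc y)"
      proof (intro allI impI)
        fix m assume "m < s"
        then have "eval f [m, x, k] (Suc 0)" using f[of m x k] that(2) by simp
        then show "\<exists>y. eval f [m, x, k] (Suc y)" ..
      qed
    qed
  qed
  \<comment> \<open>The divergence half: by \<open>eval_det\<close> a search that stops has found a
    stage at which the string is ready, so it cannot stop on an unresolved string.\<close>
  have div: "ready (sdec x) s" if "eval (Mu f) [x, k] s" for x k s
  proof -
    have "eval f [s, x, k] 0" using that by (elim eval_MuE)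
    from eval_det[OF this f] show ?thesis by simp
  qed
  show ?thesis unfolding computable_mart_def
  proof (intro exI allI)
    fix \<sigma>
    show "case gambler \<sigma> of
        None \<Rightarrow> \<forall>k v. \<not> eval r [str_code \<sigma>, k] v
      | Some x \<Rightarrow> \<forall>k. \<exists>v. eval r [str_code \<sigma>, k] v \<and> \<bar>rat_code v - x\<bar> \<le> (1/2) ^ k"
    proof (cases "resolved \<sigma>")
      case True
      define s where "s = (LEAST s. ready \<sigma> s)"
      have s: "ready \<sigma> s" using resolved_ready[OF True] unfolding s_def by (rule LeastI_ex)
      have min: "\<not> ready \<sigma> s'" if "s' < s" for s'
        using that unfolding s_def by (rule not_less_Least)
      have "eval r [str_code \<sigma>, k] (pair (2 * capital s \<sigma>) 0)" for k
        using r[of "str_code \<sigma>" s k] s min by simp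
      moreover have "rat_code (pair (2 * capital s \<sigma>) 0) = wealth \<sigma>"
        using capital_ready[OF s] by (simp add: rat_code_fraction)
      ultimately have "\<exists>v. eval r [str_code \<sigma>, k] v \<and> \<bar>rat_code v - wealth \<sigma>\<bar> \<le> (1/2) ^ k" for k
        by (intro exI[of _ "pair (2 * capital s \<sigma>) 0"]) simp
      then show ?thesis using True by (simp add: gambler_def)
    next
      case False
      have "\<not> eval r [str_code \<sigma>, k] v" for k v
      proof
        assume "eval r [str_code \<sigma>, k] v"
        then obtain s where "eval (Mu f) [str_code \<sigma>, k] s"
          unfolding r_def by (elim eval_CompE) (auto simp: list_all2_Cons1)
        from div[OF this] show False using False ready_resolved by simp
      qed
      then show ?thesis using False by (simp add: gambler_def)
    qed
  qed
qed

section \<open>The sequence\<close>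

lemma rnum_div_rden: "rnum v / rden v = max 0 (rat_code v)"
  by (auto simp: rnum_def rden_def rat_code_def pfst_def psnd_def int_decode_def sum_decode_def
      case_prod_unfold max_def zero_le_divide_iff divide_le_0_iff mod2_eq_if)

lemma exceeds_iff: "exceeds k v w \<longleftrightarrow> max 0 (rat_code w) + 2 / 2 ^ k < max 0 (rat_code v)"
proof -
  have "exceeds k v w \<longleftrightarrow> real (rnum w * rden v * 2 ^ k + 2 * rden v * rden w) < real (rnum v * rden w * 2 ^ k)"
    unfolding exceeds_def of_nat_less_iff ..
  also have "\<dots> \<longleftrightarrow> rnum w / rden w + 2 / 2 ^ k < rnum v / rden v"
  proof -
    have "0 < real (rden v)" "0 < real (rden w)" by (simp_all add: rden_def)
    then show ?thesis by (simp add: field_simps)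
  qed
  finally show ?thesis unfolding rnum_div_rden .
qed

lemma computed_mono:
  assumes "computed \<tau> s" "s \<le> s'"
  shows "computed \<tau> s'" "raised a \<tau> s' = raised a \<tau> s"
proof -
  define k where "k = length \<tau> div 3"
  have *: "val j \<tau> k s' = val j \<tau> k s" "val j (ext \<tau> b) k s' = val j (ext \<tau> b) k s"
    "val j \<tau> k s \<noteq> 0" "val j (ext \<tau> b) k s \<noteq> 0"
    if "j < k" "active j \<tau>" for j b
    using assms that unfolding computed_def Let_def k_def[symmetric] val_def
    by (cases b; auto intro!: run_halted)+
  show "computed \<tau> s'"
    unfolding computed_def Let_def k_def[symmetric] by (auto simp: * simp del: append_assoc)
  show "raised a \<tau> s' = raised a \<tau> s"
    unfolding raised_def Let_def k_def[symmetric] using * by auto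
qed

lemma verdict_stable:
  assumes "computed \<tau> s" "computed \<tau> s'"
  shows "verdict \<tau> s = verdict \<tau> s'"
  using computed_mono(2)[of \<tau> s s'] computed_mono(2)[of \<tau> s' s] assms
  by (cases s s' rule: le_cases) (simp_all add: verdict_def)

lemma mu_nonneg: "0 \<le> mu \<mu> \<sigma>"
  by (simp add: mu_def)

text \<open>The term of the sibling in the fairness equation is non-negative, and 0 if the sibling
  is null; dividing by the positive mass of \<open>\<sigma>\<close> gives both claims.\<close>

lemma martingale_fair:
  assumes M: "martingale \<mu> M" and pos: "0 < mu \<mu> (\<sigma> @ [b])"
    and "mu \<mu> (\<sigma> @ [b]) = q * mu \<mu> \<sigma>"
  shows "q * the (M (\<sigma> @ [b])) \<le> the (M \<sigma>)"
    and "mu \<mu> (\<sigma> @ [\<not> b]) = 0 \<Longrightarrow> q * the (M (\<sigma> @ [b])) = the (M \<sigma>)"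
proof -
  define t where "t \<tau> = (if mu \<mu> \<tau> = 0 then 0 else the (M \<tau>) * mu \<mu> \<tau>)" for \<tau>
  have "t (\<sigma> @ [False]) + t (\<sigma> @ [True]) = t \<sigma>"
    using M by (simp add: martingale_def t_def[abs_def] Let_def)
  then have sum: "t (\<sigma> @ [b]) + t (\<sigma> @ [\<not> b]) = t \<sigma>" by (cases b) simp_all
  have nonneg: "0 \<le> t \<tau>" for \<tau>
    using M mu_nonneg[of \<mu> \<tau>] unfolding martingale_def t_def by force
  have pos': "0 < mu \<mu> \<sigma>"
    using assms(3) pos mu_nonneg[of \<mu> \<sigma>] by (cases "mu \<mu> \<sigma> = 0") auto
  have eq: "t (\<sigma> @ [b]) = q * the (M (\<sigma> @ [b])) * mu \<mu> \<sigma>" "t \<sigma> = the (M \<sigma>) * mu \<mu> \<sigma>"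
    using pos pos' assms(3) by (auto simp: t_def)
  show "q * the (M (\<sigma> @ [b])) \<le> the (M \<sigma>)"
    using sum nonneg[of "\<sigma> @ [\<not> b]"] pos' unfolding eq by (metis add_increasing2 le_add_same_cancel1 mult_right_le_imp_le)
  show "q * the (M (\<sigma> @ [b])) = the (M \<sigma>)" if "mu \<mu> (\<sigma> @ [\<not> b]) = 0"
    using sum that pos' unfolding eq by (simp add: t_def)
qed

lemma base_block: "length \<tau> mod 3 = 0 \<Longrightarrow> base \<tau> = \<tau> \<and> base (\<tau> @ [b]) = \<tau> \<and> base ((\<tau> @ [b]) @ [c]) = \<tau>"
proof -
  assume "length \<tau> mod 3 = 0"
  then have "length (\<tau> @ [b]) mod 3 = 1" by (simp add: mod_Suc)
  then show ?thesis using \<open>length \<tau> mod 3 = 0\<close> by (simp only: base_snoc base_id) simp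
qed

lemma prob0_block:
  assumes "length \<tau> mod 3 = 0"
  shows "prob0 \<tau> = (if final \<tau> = 0 then 1/2 else 1)"
    "prob0 (\<tau> @ [b]) = (if final \<tau> = 0 then 1/2 else if final \<tau> = 2 then 0 else 1)"
    "prob0 ((\<tau> @ [b]) @ [c]) = (if final \<tau> = 0 then weight (((\<tau> @ [b]) @ [c]) @ [False]) else 1)"
proof -
  have l: "length (\<tau> @ [b]) mod 3 = 1" "length ((\<tau> @ [b]) @ [c]) mod 3 = 2"
    using assms by (simp_all add: mod_Suc)
  note b = base_block[OF assms, of b c]
  show "prob0 \<tau> = (if final \<tau> = 0 then 1/2 else 1)"
    using assms b by (simp add: prob0_def cond_def)
  show "prob0 (\<tau> @ [b]) = (if final \<tau> = 0 then 1/2 else if final \<tau> = 2 then 0 else 1)"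
    unfolding prob0_def cond_def using l b by simp
  show "prob0 ((\<tau> @ [b]) @ [c]) = (if final \<tau> = 0 then weight (((\<tau> @ [b]) @ [c]) @ [False]) else 1)"
    unfolding prob0_def cond_def using l b by simp
qed

section \<open>The sequence whose claims are exactly the true ones\<close>

definition computes :: "recf \<Rightarrow> (bool list \<Rightarrow> real option) \<Rightarrow> bool" where
  "computes r M \<longleftrightarrow>
     (\<forall>\<sigma> k. \<exists>v. eval r [str_code \<sigma>, k] v \<and> \<bar>rat_code v - the (M \<sigma>)\<bar> \<le> (1/2) ^ k)"

definition sound :: "(nat \<Rightarrow> bool) measure \<Rightarrow> nat \<Rightarrow> bool" where
  "sound \<mu> j \<longleftrightarrow> (\<exists>r M. j = recf_code r \<and> martingale \<mu> M \<and> total_mart M \<and> computes r M)"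

text \<open>No circularity arises from \<open>\<mu>\<close> occurring here: \<open>prob0\<close>
  refers to runs and claims, never to soundness.\<close>

definition victim :: "(nat \<Rightarrow> bool) measure \<Rightarrow> nat \<Rightarrow> bool" where
  "victim \<mu> n \<longleftrightarrow> n mod 3 = 1 \<and> sound \<mu> (n div 3)"

definition node :: "(nat \<Rightarrow> bool) measure \<Rightarrow> nat \<Rightarrow> bool list" where
  "node \<mu> i = prefix (victim \<mu>) (3 * i)"

lemma length_node [simp]: "length (node \<mu> i) = 3 * i"
  by (simp add: node_def prefix_def)

lemma prefix_Suc: "prefix X (Suc n) = prefix X n @ [X n]"
  by (simp add: prefix_def)

lemma prefix_after_node:
  "prefix (victim \<mu>) (3 * i) = node \<mu> i"
  "prefix (victim \<mu>) (Suc (3 * i)) = node \<mu> i @ [False]"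
  "prefix (victim \<mu>) (Suc (Suc (3 * i))) = (node \<mu> i @ [False]) @ [sound \<mu> i]"
  "prefix (victim \<mu>) (Suc (Suc (Suc (3 * i)))) = ext (node \<mu> i) (sound \<mu> i)"
proof -
  have "\<not> victim \<mu> (3 * i)" by (simp add: victim_def)
  moreover have "Suc (3 * i) mod 3 = 1" "Suc (3 * i) div 3 = i" "Suc (Suc (3 * i)) mod 3 = 2" by presburger+
  then have "victim \<mu> (Suc (3 * i)) = sound \<mu> i" "\<not> victim \<mu> (Suc (Suc (3 * i)))"
    unfolding victim_def by simp_all
  ultimately show "prefix (victim \<mu>) (3 * i) = node \<mu> i"
    "prefix (victim \<mu>) (Suc (3 * i)) = node \<mu> i @ [False]"
    "prefix (victim \<mu>) (Suc (Suc (3 * i))) = (node \<mu> i @ [False]) @ [sound \<mu> i]"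
    "prefix (victim \<mu>) (Suc (Suc (Suc (3 * i)))) = ext (node \<mu> i) (sound \<mu> i)"
    by (simp_all add: prefix_Suc node_def)
qed

lemma node_Suc: "node \<mu> (Suc i) = ext (node \<mu> i) (sound \<mu> i)"
proof -
  have "3 * Suc i = Suc (Suc (Suc (3 * i)))" by simp
  then show ?thesis unfolding node_def[of _ "Suc i"] by (simp only: prefix_after_node)
qed

lemma take_node: "i \<le> k \<Longrightarrow> take (3 * i) (node \<mu> k) = node \<mu> i"
  by (simp add: node_def prefix_def take_map)

lemma sbit_node: "sbit (node \<mu> i) n \<longleftrightarrow> n < 3 * i \<and> victim \<mu> n"
  by (auto simp: sbit_def node_def prefix_def)

lemma active_node: "j < i \<Longrightarrow> active j (node \<mu> i) \<longleftrightarrow> sound \<mu> j"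
proof -
  have "(3 * j + 1) div 3 = j" "(3 * j + 1) mod 3 = 1" by presburger+
  then show "j < i \<Longrightarrow> ?thesis" unfolding active_def sbit_node victim_def by simp
qed

lemma not_dead_node: "\<not> dead (node \<mu> i)"
proof -
  have "(3 * j + 2) mod 3 \<noteq> 1" for j :: nat by presburger
  then show ?thesis unfolding dead_def sbit_node victim_def by blast
qed

lemma sound_run:
  assumes "sound \<mu> j"
  shows "\<exists>s. run j (str_code \<sigma>) k s \<noteq> 0"
proof -
  obtain r M where "j = recf_code r" "computes r M" using assms unfolding sound_def by blast
  then show ?thesis unfolding computes_def by (metis eval_run nat.distinct(1))
qed

lemma computed_node: "\<exists>s. computed (node \<mu> i) s"
proof -
  let ?\<tau> = "node \<mu> i"
  let ?h = "\<lambda>j \<sigma> s. val j \<sigma> i s \<noteq> 0"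
  have "\<exists>s. ?h j \<sigma> s" if "sound \<mu> j" for j \<sigma>
    using sound_run[OF that] unfolding val_def by blast
  then obtain f where f: "\<And>j \<sigma>. sound \<mu> j \<Longrightarrow> ?h j \<sigma> (f j \<sigma>)" by metis
  define A where "A = {..<i} \<times> {?\<tau>, ext ?\<tau> False, ext ?\<tau> True}"
  \<comment> \<open>A sum bounds each of its finitely many terms, and halted runs keep their value,
    so one time serves all programs and strings.\<close>
  define s where "s = (\<Sum>(j, \<sigma>)\<in>A. f j \<sigma>)"
  have "?h j \<sigma> s" if "sound \<mu> j" "(j, \<sigma>) \<in> A" for j \<sigma>
  proof -
    have "f j \<sigma> \<le> s"
      unfolding s_def using member_le_sum[of "(j, \<sigma>)" A "\<lambda>(j, \<sigma>). f j \<sigma>"] that(2) by (simp add: A_def)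
    with f[OF that(1), of \<sigma>] show ?thesis unfolding val_def by (metis run_halted)
  qed
  then have "computed ?\<tau> s"
    unfolding computed_def Let_def by (simp add: active_node A_def)
  then show ?thesis ..
qed

lemma val_approximates:
  assumes "computes r M" "val (recf_code r) \<sigma> k s \<noteq> 0"
  shows "\<bar>rat_code (val (recf_code r) \<sigma> k s - 1) - the (M \<sigma>)\<bar> \<le> (1/2) ^ k"
proof -
  obtain v where v: "eval r [str_code \<sigma>, k] v" "\<bar>rat_code v - the (M \<sigma>)\<bar> \<le> (1/2) ^ k"
    using assms(1) unfolding computes_def by blast
  have "run (recf_code r) (str_code \<sigma>) k s = Suc v"
    using run_eval[OF v(1)] assms(2) unfolding val_def .
  then show ?thesis using v(2) by (simp add: val_def)
qed

lemma martingale_nonneg: "martingale \<mu> M \<Longrightarrow> total_mart M \<Longrightarrow> 0 \<le> the (M \<sigma>)"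
  unfolding martingale_def total_mart_def by (metis option.collapse)

lemma computed_vals:
  assumes "computed \<tau> s" "j < length \<tau> div 3" "active j \<tau>"
  shows "val j \<tau> (length \<tau> div 3) s \<noteq> 0" "val j (ext \<tau> a) (length \<tau> div 3) s \<noteq> 0"
  using assms unfolding computed_def Let_def by (cases a; auto)+

section \<open>Mass, verdicts and capital along the sequence\<close>

context
  fixes \<mu> :: "(nat \<Rightarrow> bool) measure"
  assumes mu: "mu \<mu> \<sigma> = cprod prob0 \<sigma>"
begin

text \<open>Claims along the sequence are true, so both values approximate a real martingale; the
  margin of two units of precision in \<open>exceeds\<close> absorbs the two approximation
  errors.\<close>

lemma raised_node:
  assumes "computed (node \<mu> i) s" "raised a (node \<mu> i) s"
  shows "\<exists>M. martingale \<mu> M \<and> the (M (node \<mu> i)) < the (M (ext (node \<mu> i) a))"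
proof -
  let ?\<tau> = "node \<mu> i"
  obtain j where j: "j < i" "active j ?\<tau>" "exceeds i (val j (ext ?\<tau> a) i s - 1) (val j ?\<tau> i s - 1)"
    using assms(2) unfolding raised_def Let_def by auto
  then obtain r M where M: "j = recf_code r" "martingale \<mu> M" "total_mart M" "computes r M"
    by (auto simp: active_node sound_def)
  have "val j ?\<tau> i s \<noteq> 0" "val j (ext ?\<tau> a) i s \<noteq> 0"
    using computed_vals(1)[OF assms(1), of j] computed_vals(2)[OF assms(1), of j a] j(1,2) by simp_all
  then have "\<bar>rat_code (val j ?\<tau> i s - 1) - the (M ?\<tau>)\<bar> \<le> (1/2) ^ i"
    "\<bar>rat_code (val j (ext ?\<tau> a) i s - 1) - the (M (ext ?\<tau> a))\<bar> \<le> (1/2) ^ i"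
    using val_approximates[OF M(4)] M(1) by simp_all
  moreover have "0 \<le> the (M ?\<tau>)" "0 \<le> the (M (ext ?\<tau> a))"
    by (rule martingale_nonneg[OF M(2,3)])+
  ultimately have "the (M ?\<tau>) < the (M (ext ?\<tau> a))"
    using j(3) by (simp add: exceeds_iff power_one_over)
  with M show ?thesis by blast
qed

text \<open>A non-zero verdict would move all mass of the node along the three bits of
  \<open>ext ?\<tau> a\<close>, each with conditional probability 1. Every martingale is then
  constant on this path, but the verdict was caused by one that is larger at its end.\<close>

lemma final_node_0:
  assumes pos: "0 < cprod prob0 (node \<mu> i)"
  shows "final (node \<mu> i) = 0"
proof (rule ccontr)
  let ?\<tau> = "node \<mu> i"
  assume F: "final ?\<tau> \<noteq> 0"
  define a where "a \<longleftrightarrow> final ?\<tau> = 2"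
  have fin: "final ?\<tau> = (if a then 2 else 1)"
    using F by (auto simp: final_def verdict_def a_def split: if_splits)
  then have "computed ?\<tau> (htime ?\<tau>)" "raised a ?\<tau> (htime ?\<tau>)"
    by (auto simp: final_def verdict_def split: if_splits)
  then obtain M where M: "martingale \<mu> M" "the (M ?\<tau>) < the (M (ext ?\<tau> a))"
    using raised_node by blast
  have l: "length ?\<tau> mod 3 = 0" by simp
  note p = prob0_block[OF l]
  have m: "cprod prob0 (?\<tau> @ [False]) = cprod prob0 ?\<tau>"
    "cprod prob0 ((?\<tau> @ [False]) @ [a]) = cprod prob0 ?\<tau>"
    "cprod prob0 (ext ?\<tau> a) = cprod prob0 ?\<tau>"
    using fin by (simp_all only: cprod_snoc p) (auto split: if_splits)
  have z: "cprod prob0 (?\<tau> @ [True]) = 0" "cprod prob0 ((?\<tau> @ [False]) @ [\<not> a]) = 0"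
    "cprod prob0 (((?\<tau> @ [False]) @ [a]) @ [True]) = 0"
    using fin by (simp_all only: cprod_snoc p) (auto split: if_splits)
  have "the (M (?\<tau> @ [False])) = the (M ?\<tau>)"
    using martingale_fair(2)[OF M(1), of ?\<tau> False 1] pos m z by (simp add: mu del: cprod_snoc)
  moreover have "the (M ((?\<tau> @ [False]) @ [a])) = the (M (?\<tau> @ [False]))"
    using martingale_fair(2)[OF M(1), of "?\<tau> @ [False]" a 1] pos m z
    by (simp add: mu del: cprod_snoc append_assoc)
  moreover have "the (M (ext ?\<tau> a)) = the (M ((?\<tau> @ [False]) @ [a]))"
    using martingale_fair(2)[OF M(1), of "(?\<tau> @ [False]) @ [a]" False 1] pos m z
    by (simp add: mu del: cprod_snoc append_assoc)
  ultimately show False using M(2) by simp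
qed

text \<open>The two halves support each other. As long as no earlier node has a non-zero verdict, a
  node can be settled only by being computed, so its final verdict is the genuine one and
  \<open>verdict_stable\<close> makes it 0 at every stage. A fair block in turn passes on 1/4 of the
  mass times a positive weight.\<close>

lemma node_invariant: "0 < cprod prob0 (node \<mu> i) \<and> (\<forall>k<i. \<forall>s. verdict (node \<mu> k) s = 0)"
proof (induction i)
  case 0
  then show ?case by (simp add: node_def prefix_def)
next
  case (Suc i)
  let ?\<tau> = "node \<mu> i"
  have fin: "final ?\<tau> = 0" using Suc final_node_0 by blast
  have iff: "settled ?\<tau> s \<longleftrightarrow> computed ?\<tau> s" for s
    using Suc take_node[of _ i \<mu>] not_dead_node[of \<mu> i] unfolding settled_def by auto
  have v: "verdict ?\<tau> s = 0" for s
  proof (cases "computed ?\<tau> s")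
    case True
    then have "computed ?\<tau> (htime ?\<tau>)" using iff settled_htime by blast
    from verdict_stable[OF True this] fin show ?thesis by (simp add: final_def)
  qed (simp add: verdict_def)
  have "settled (node \<mu> (Suc i)) s" if "computed (node \<mu> (Suc i)) s" for s
    using that unfolding settled_def by blast
  then have "halting (node \<mu> (Suc i))" using computed_node unfolding halting_def by blast
  then have w: "0 < weight (ext ?\<tau> (sound \<mu> i))" by (simp add: weight_def node_Suc)
  have "cprod prob0 (node \<mu> (Suc i)) = cprod prob0 ?\<tau> * (1/2) * (1/2) * weight (ext ?\<tau> (sound \<mu> i))"
    unfolding node_Suc using fin by (simp only: cprod_snoc prob0_block length_node mod_mult_self1_is_0) auto
  also have "0 < \<dots>" using Suc w by (intro mult_pos_pos) simp_all
  finally have "0 < cprod prob0 (node \<mu> (Suc i))" .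
  then show ?case using Suc v by (auto simp: less_Suc_eq)
qed

lemma computed_htime_node: "computed (node \<mu> i) (htime (node \<mu> i))"
proof -
  have "settled (node \<mu> i) s \<longleftrightarrow> computed (node \<mu> i) s" for s
    using node_invariant[of i] take_node[of _ i \<mu>] not_dead_node[of \<mu> i] unfolding settled_def by auto
  then show ?thesis using computed_node settled_htime by blast
qed

lemma final_node: "final (node \<mu> i) = 0"
  using final_node_0 node_invariant by blast

lemma gambler_succeeds: "succeeds gambler (victim \<mu>)"
proof -
  have w: "wealth (node \<mu> i) = 2 ^ i" for i
  proof (induction i)
    case 0
    then show ?case by (simp add: node_def prefix_def wealth_def)
  next
    case (Suc i)
    then show ?case unfolding node_Suc by (simp only: wealth_snoc) (simp add: final_node mod_Suc)
  qed
  have g: "gambler (node \<mu> i) = Some (2 ^ i)" for i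
    using node_invariant[of i] resolved_of_pos by (simp add: gambler_def w)
  show ?thesis unfolding succeeds_def
  proof (intro allI)
    fix C :: real and N :: nat
    obtain k where k: "C < 2 ^ k" using real_arch_pow[of 2 C] by auto
    have "(2::real) ^ k \<le> 2 ^ max k N" by (intro power_increasing) auto
    with k have "C < 2 ^ max k N" by linarith
    then show "\<exists>n\<ge>N. \<exists>v. gambler (prefix (victim \<mu>) n) = Some v \<and> C < v"
      using g[of "max k N"] by (intro exI[of _ "3 * max k N"]) (auto simp: node_def)
  qed
qed

text \<open>The code \<open>j\<close> of a program for \<open>M\<close> is a true claim, hence
  active at every node after block \<open>j\<close>. From there on the verdict 0 says that no
  visible rise of \<open>M\<close> occurs over the next block.\<close>

lemma total_fails:
  assumes M: "martingale \<mu> M" "total_mart M" "computable_mart M"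
  shows "\<not> succeeds M (victim \<mu>)"
proof -
  obtain r where r: "\<And>\<sigma>. case M \<sigma> of None \<Rightarrow> \<forall>k v. \<not> eval r [str_code \<sigma>, k] v
      | Some x \<Rightarrow> \<forall>k. \<exists>v. eval r [str_code \<sigma>, k] v \<and> \<bar>rat_code v - x\<bar> \<le> (1/2) ^ k"
    using M(3) unfolding computable_mart_def by blast
  have comp: "computes r M"
    unfolding computes_def
  proof (intro allI)
    fix \<sigma> k
    obtain x where x: "M \<sigma> = Some x" using M(2) unfolding total_mart_def by blast
    show "\<exists>v. eval r [str_code \<sigma>, k] v \<and> \<bar>rat_code v - the (M \<sigma>)\<bar> \<le> (1/2) ^ k"
      using r[of \<sigma>] x by simp
  qed
  define j where "j = recf_code r"
  have sound: "sound \<mu> j" using M comp unfolding sound_def j_def by blast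
  let ?M = "\<lambda>\<sigma>. the (M \<sigma>)"
  have nonneg: "0 \<le> ?M \<sigma>" for \<sigma> by (rule martingale_nonneg[OF M(1,2)])
  \<comment> \<open>The 4 consists of the 2 tolerated by \<open>exceeds\<close> and one unit of
    precision for each of the two values. Clamping at 0 is harmless since \<open>M\<close> is
    non-negative.\<close>
  have growth: "?M (node \<mu> (Suc i)) \<le> ?M (node \<mu> i) + 4 / 2 ^ i" if "j < i" for i
  proof -
    let ?\<tau> = "node \<mu> i" and ?a = "sound \<mu> i"
    let ?s = "htime ?\<tau>"
    have act: "active j ?\<tau>" using sound that by (simp add: active_node)
    have "\<not> raised ?a ?\<tau> ?s"
      using final_node[of i] computed_htime_node[of i] by (cases ?a) (auto simp: final_def verdict_def split: if_splits)
    then have "\<not> exceeds i (val j (ext ?\<tau> ?a) i ?s - 1) (val j ?\<tau> i ?s - 1)"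
      using act that unfolding raised_def Let_def by auto
    moreover have "val j ?\<tau> i ?s \<noteq> 0" "val j (ext ?\<tau> ?a) i ?s \<noteq> 0"
      using computed_vals(1)[OF computed_htime_node[of i], of j]
        computed_vals(2)[OF computed_htime_node[of i], of j ?a] act that by simp_all
    then have "\<bar>rat_code (val j ?\<tau> i ?s - 1) - ?M ?\<tau>\<bar> \<le> (1/2) ^ i"
      "\<bar>rat_code (val j (ext ?\<tau> ?a) i ?s - 1) - ?M (ext ?\<tau> ?a)\<bar> \<le> (1/2) ^ i"
      using val_approximates[OF comp] by (simp_all add: j_def)
    ultimately show ?thesis
      using nonneg[of ?\<tau>] by (simp add: exceeds_iff node_Suc power_one_over)
  qed
  \<comment> \<open>The sum of the increments \<open>4 / 2 ^ i\<close>, in a form that telescopes: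
    \<open>8 / 2 ^ i - 4 / 2 ^ i = 8 / 2 ^ Suc i\<close>.\<close>
  have "?M (node \<mu> i) \<le> ?M (node \<mu> (Suc j)) + (8 - 8 / 2 ^ i)" if "Suc j \<le> i" for i
    using that
  proof (induction i rule: dec_induct)
    case base
    show ?case using one_le_power[of "2::real" "Suc j"] by (simp add: divide_le_eq del: power_Suc)
  next
    case (step i)
    have "?M (node \<mu> (Suc i)) \<le> ?M (node \<mu> i) + 4 / 2 ^ i" using step.hyps by (intro growth) simp
    with step.IH show ?case by simp
  qed
  moreover define B where "B = ?M (node \<mu> (Suc j)) + 8"
  ultimately have node_bound: "?M (node \<mu> i) \<le> B" if "Suc j \<le> i" for i
    using that by (smt (verit) zero_le_divide_iff zero_le_power)
  have "0 \<le> B" using nonneg[of "node \<mu> (Suc j)"] by (simp add: B_def)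
  \<comment> \<open>Inside a block only the fair bits b and a can be passed before the next node,
    and a fair bit at most doubles a martingale; hence the factor 4.\<close>
  have prefix_bound: "?M (prefix (victim \<mu>) n) \<le> 4 * B" if "3 * Suc j \<le> n" for n
  proof -
    define i where "i = n div 3"
    have i: "Suc j \<le> i" using that unfolding i_def by presburger
    let ?\<tau> = "node \<mu> i"
    have l: "length ?\<tau> mod 3 = 0" by simp
    note p = prob0_block[OF l]
    have pos: "0 < cprod prob0 ?\<tau>" using node_invariant by blast
    have m: "cprod prob0 (?\<tau> @ [False]) = 1/2 * cprod prob0 ?\<tau>"
      "cprod prob0 ((?\<tau> @ [False]) @ [a]) = 1/2 * cprod prob0 (?\<tau> @ [False])" for a
      by (simp_all only: cprod_snoc p final_node) auto
    have 1: "1/2 * ?M (?\<tau> @ [False]) \<le> ?M ?\<tau>"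
      using martingale_fair(1)[OF M(1), of ?\<tau> False "1/2"] pos m(1) by (simp add: mu del: cprod_snoc)
    have 2: "1/2 * ?M ((?\<tau> @ [False]) @ [a]) \<le> ?M (?\<tau> @ [False])" for a
      using martingale_fair(1)[OF M(1), of "?\<tau> @ [False]" a "1/2"] pos m
      by (simp add: mu del: cprod_snoc append_assoc)
    have "n = 3 * i \<or> n = Suc (3 * i) \<or> n = Suc (Suc (3 * i))" unfolding i_def by presburger
    then show ?thesis
      using prefix_after_node[of \<mu> i] 1 2[of "sound \<mu> i"] node_bound[OF i] \<open>0 \<le> B\<close>
      by (elim disjE) (simp_all del: append_assoc)
  qed
  show ?thesis
  proof
    assume "succeeds M (victim \<mu>)"
    then obtain n v where "3 * Suc j \<le> n" "M (prefix (victim \<mu>) n) = Some v" "4 * B < v"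
      unfolding succeeds_def by meson
    with prefix_bound[of n] show False by simp
  qed
qed

end

theorem mainTheorem1:
  shows "\<exists>\<mu> X. prob_measure_cantor \<mu> \<and> computable_measure \<mu> \<and>
     \<not> computably_random \<mu> X \<and>
     (\<forall>M. martingale \<mu> M \<and> total_mart M \<and> computable_mart M \<longrightarrow> \<not> succeeds M X)"
proof -
  obtain \<mu> where \<mu>: "prob_measure_cantor \<mu>" "\<And>\<sigma>. mu \<mu> \<sigma> = cprod prob0 \<sigma>"
    using measure_of_conditional_probabilities[of prob0] prob0_bounds by blast
  have "\<not> computably_random \<mu> (victim \<mu>)"
    unfolding computably_random_def
    using martingale_gambler[OF \<mu>(2)] computable_gambler gambler_succeeds[OF \<mu>(2)] by blast
  moreover have "computable_measure \<mu>" by (rule computable_measure_prob0[OF \<mu>(2)])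
  ultimately show ?thesis using \<mu>(1) total_fails[OF \<mu>(2)] by blast
qed

end
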